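(* Let $j_1,j_2,j_3,j_4\in\{0,\tfrac12,1,\dots\}$ be such that $\mathcal{H}_{\mathrm{inv}}=\mathrm{Inv}_{SU(2)}(V_{j_1}\otimes V_{j_2}\otimes V_{j_3}\otimes V_{j_4})\neq 0$. Let $|I\rangle$ be a Haar-random unit vector in $\mathcal{H}_{\mathrm{inv}}$, let $\rho=|I\rangle\langle I|$, let $\rho_{34}=\mathrm{Tr}_{12}\,\rho$ be the reduced density matrix on $V_{j_3}\otimes V_{j_4}$, and put $Z_1=\mathrm{Tr}\,\rho_{34}^2$ and $Z_0=(\mathrm{Tr}\,\rho_{34})^2$. Then, with overline denoting the Haar average, $$\overline{Z_1}=\frac{2\sum_{I}(2I+1)^{-1}}{\dim(\mathcal{H}_{\mathrm{inv}})^2+\dim(\mathcal{H}_{\mathrm{inv}})},\qquad \overline{Z_0}=1,$$ where the sum runs over all intermediate spins $I$ that occur both in $V_{j_1}\otimes V_{j_2}$ and in $V_{j_3}\otimes V_{j_4}$. Consequently, with $\overline{S_2}:=-\ln\frac{\overline{Z_1}}{\overline{Z_0}}$, $$\overline{S_2}=\ln\!\left[\dim(\mathcal{H}_{\mathrm{inv}})^2+\dim(\mathcal{H}_{\mathrm{inv}})\right]-\ln\Big(2\sum_I (2I+1)^{-1}\Big).$$ In particular, if $j_1=j_2=j_3=j_4=j$, then $\dim\mathcal{H}_{\mathrm{inv}}=2j+1$, $$\overline{S_2}=\ln\!\left[(2j+1)^2+(2j+1)\right]-\ln\Big(2\sum_{I=0}^{2j}(2I+1)^{-1}\Big),$$ and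 $\overline{S_2}\sim\ln[(2j+1)^2]$ as $j\to\infty$, i.e. $\overline{S_2}/\ln[(2j+1)^2]\to 1$.
   Context: $V_j$ is the irreducible spin-$j$ representation of $SU(2)$ of dimension $2j+1$ with its invariant Hermitian inner product, and $\mathrm{Inv}_{SU(2)}(\cdot)$ denotes the subspace of vectors fixed by the diagonal $SU(2)$ action. A Haar-random unit vector in $\mathcal{H}_{\mathrm{inv}}$ is $U|0\rangle$ with $|0\rangle$ a fixed unit vector in $\mathcal{H}_{\mathrm{inv}}$ and $U$ distributed according to Haar measure on the unitary group of $\mathcal{H}_{\mathrm{inv}}$. The irreducible representations $V_I$ occurring in $V_{a}\otimes V_{b}$ are those with $I\in\{|a-b|,|a-b|+1,\dots,a+b\}$. The symbol $\overline{S_2}$ (the "averaged second Rényi entropy") is defined as $-\ln(\overline{Z_1}/\overline{Z_0})$, not as the Haar average of $-\ln(Z_1/Z_0)$. In the equal-spin sum, $I$ runs over the integers $0,1,\dots,2j$. *)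

theory Defs
  imports
    "HOL-Probability.Probability"
    "HOL-Computational_Algebra.Polynomial"
    "HOL-Library.Function_Algebras"
begin

section \<open>Finite-dimensional Hilbert spaces with an orthonormal basis indexed by a finite set\<close>

text \<open>
  The dimensions vary inside the statement, so vectors of \<open>\<complex>\<^sup>B\<close> (\<open>B\<close> a finite set) are functions
  that vanish outside \<open>B\<close>, and matrices are functions of the row and the column index.
\<close>

type_synonym 'i cvec = "'i \<Rightarrow> complex"
type_synonym ('i, 'k) cmat = "'i \<Rightarrow> 'k \<Rightarrow> complex"

definition cspace :: "'i set \<Rightarrow> 'i cvec set" where
  "cspace B = {v. \<forall>i. i \<notin> B \<longrightarrow> v i = 0}"

definition cinner :: "'i set \<Rightarrow> 'i cvec \<Rightarrow> 'i cvec \<Rightarrow> complex" where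
  "cinner B v w = (\<Sum>i\<in>B. cnj (v i) * w i)"

definition mat_app :: "'k set \<Rightarrow> ('i, 'k) cmat \<Rightarrow> 'k cvec \<Rightarrow> 'i cvec" where
  "mat_app B A v = (\<lambda>i. \<Sum>k\<in>B. A i k * v k)"

definition mat_mul :: "'k set \<Rightarrow> ('i, 'k) cmat \<Rightarrow> ('k, 'l) cmat \<Rightarrow> ('i, 'l) cmat" where
  "mat_mul B A C = (\<lambda>i l. \<Sum>k\<in>B. A i k * C k l)"

definition mat_trace :: "'i set \<Rightarrow> ('i, 'i) cmat \<Rightarrow> complex" where
  "mat_trace B A = (\<Sum>i\<in>B. A i i)"

definition kron :: "('i, 'k) cmat \<Rightarrow> ('i2, 'k2) cmat \<Rightarrow> ('i \<times> 'i2, 'k \<times> 'k2) cmat" where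
  "kron A C = (\<lambda>(i, i2) (k, k2). A i k * C i2 k2)"

definition ket_bra :: "'i cvec \<Rightarrow> ('i, 'i) cmat" where
  "ket_bra v = (\<lambda>i k. v i * cnj (v k))"

definition partial_trace_fst ::
    "'i set \<Rightarrow> ('i \<times> 'k, 'i \<times> 'k) cmat \<Rightarrow> ('k, 'k) cmat" where
  "partial_trace_fst B A = (\<lambda>k l. \<Sum>i\<in>B. A (i, k) (i, l))"

definition cscale :: "complex \<Rightarrow> 'i cvec \<Rightarrow> 'i cvec" where
  "cscale c v = (\<lambda>i. c * v i)"

interpretation cvec: vector_space cscale
  by unfold_locales (auto simp: cscale_def plus_fun_def algebra_simps)

definition cdim :: "'i cvec set \<Rightarrow> nat" where
  "cdim S = cvec.dim S"

section \<open>Representations of \<open>SU(2)\<close>\<close>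

definition SU2 :: "(complex^2^2) set" where
  "SU2 = {g. g ** transpose (map_matrix cnj g) = mat 1 \<and> det g = 1}"

text \<open>
  A spin \<open>j \<in> {0, 1/2, 1, \<dots>}\<close> is encoded by the natural number \<open>n = 2j\<close>.
\<close>

definition spin :: "nat \<Rightarrow> real" where
  "spin n = real n / 2"

text \<open>
  \<open>V\<^sub>j\<close> is realised as the symmetric power \<open>Sym\<^sup>n(\<complex>\<^sup>2)\<close> with \<open>n = 2j\<close>.  Its invariant inner product
  (the one inherited from the \<open>n\<close>-fold tensor power of \<open>\<complex>\<^sup>2\<close>) makes the vectors
  \<open>u\<^sub>m = sqrt (n choose m) e\<^sub>1\<^sup>m e\<^sub>2\<^sup>n\<^sup>-\<^sup>m\<close>, \<open>m \<le> n\<close>, orthonormal, and \<open>spin_rep n g\<close> is the unitary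
  matrix of \<open>g\<close> in this basis.  It is read off from
  \<open>g (e\<^sub>1\<^sup>m e\<^sub>2\<^sup>n\<^sup>-\<^sup>m) = (g\<^sub>1\<^sub>1 e\<^sub>1 + g\<^sub>2\<^sub>1 e\<^sub>2)\<^sup>m (g\<^sub>1\<^sub>2 e\<^sub>1 + g\<^sub>2\<^sub>2 e\<^sub>2)\<^sup>n\<^sup>-\<^sup>m\<close>, dehomogenised by \<open>e\<^sub>2 = 1\<close>.
\<close>

definition spin_ix :: "nat \<Rightarrow> nat set" where
  "spin_ix n = {..n}"

definition spin_rep :: "nat \<Rightarrow> complex^2^2 \<Rightarrow> (nat, nat) cmat" where
  "spin_rep n g = (\<lambda>k m. if k \<le> n \<and> m \<le> n
     then complex_of_real (sqrt (real (n choose m) / real (n choose k))) *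
       coeff ([:g $ 2 $ 1, g $ 1 $ 1:] ^ m * [:g $ 2 $ 2, g $ 1 $ 2:] ^ (n - m)) k
     else 0)"

definition pair_ix :: "nat \<Rightarrow> nat \<Rightarrow> (nat \<times> nat) set" where
  "pair_ix a b = spin_ix a \<times> spin_ix b"

definition pair_rep :: "nat \<Rightarrow> nat \<Rightarrow> complex^2^2 \<Rightarrow> (nat \<times> nat, nat \<times> nat) cmat" where
  "pair_rep a b g = kron (spin_rep a g) (spin_rep b g)"

type_synonym quad = "(nat \<times> nat) \<times> (nat \<times> nat)"

definition quad_ix :: "nat \<Rightarrow> nat \<Rightarrow> nat \<Rightarrow> nat \<Rightarrow> quad set" where
  "quad_ix a b c d = pair_ix a b \<times> pair_ix c d"

definition quad_rep ::
    "nat \<Rightarrow> nat \<Rightarrow> nat \<Rightarrow> nat \<Rightarrow> complex^2^2 \<Rightarrow> (quad, quad) cmat" where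
  "quad_rep a b c d g = kron (pair_rep a b g) (pair_rep c d g)"

definition invariants :: "'i set \<Rightarrow> (complex^2^2 \<Rightarrow> ('i, 'i) cmat) \<Rightarrow> 'i cvec set" where
  "invariants B R = {v \<in> cspace B. \<forall>g\<in>SU2. mat_app B (R g) v = v}"

definition H_inv :: "nat \<Rightarrow> nat \<Rightarrow> nat \<Rightarrow> nat \<Rightarrow> quad cvec set" where
  "H_inv a b c d = invariants (quad_ix a b c d) (quad_rep a b c d)"

text \<open>
  \<open>V\<^sub>I\<close>, with \<open>I = spin n\<close>, occurs in the representation \<open>R\<close> on \<open>\<complex>\<^sup>B\<close> iff it embeds equivariantly.
\<close>

definition occurs_in :: "nat \<Rightarrow> 'i set \<Rightarrow> (complex^2^2 \<Rightarrow> ('i, 'i) cmat) \<Rightarrow> bool" where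
  "occurs_in n B R \<longleftrightarrow> (\<exists>T :: ('i, nat) cmat.
     mat_app (spin_ix n) T ` cspace (spin_ix n) \<subseteq> cspace B \<and>
     inj_on (mat_app (spin_ix n) T) (cspace (spin_ix n)) \<and>
     (\<forall>g\<in>SU2. \<forall>v\<in>cspace (spin_ix n).
        mat_app (spin_ix n) T (mat_app (spin_ix n) (spin_rep n g) v) =
        mat_app B (R g) (mat_app (spin_ix n) T v)))"

definition intermediate_spins :: "nat \<Rightarrow> nat \<Rightarrow> nat \<Rightarrow> nat \<Rightarrow> nat set" where
  "intermediate_spins a b c d =
     {n. occurs_in n (pair_ix a b) (pair_rep a b) \<and> occurs_in n (pair_ix c d) (pair_rep c d)}"

section \<open>Haar averages\<close>

text \<open>
  A unitary operator of a subspace \<open>H\<close> of \<open>\<complex>\<^sup>B\<close> is represented by the matrix of its extension by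
  zero to the orthogonal complement of \<open>H\<close>.
\<close>

definition unitary_group :: "'i set \<Rightarrow> 'i cvec set \<Rightarrow> ('i, 'i) cmat set" where
  "unitary_group B H = {U.
     (\<forall>i k. i \<notin> B \<or> k \<notin> B \<longrightarrow> U i k = 0) \<and>
     mat_app B U ` H = H \<and>
     (\<forall>v\<in>H. \<forall>w\<in>H. cinner B (mat_app B U v) (mat_app B U w) = cinner B v w) \<and>
     (\<forall>v\<in>cspace B. (\<forall>w\<in>H. cinner B w v = 0) \<longrightarrow> mat_app B U v = 0)}"

text \<open>
  The Haar measure is the unique left-invariant Borel probability measure on the unitary group.
  The topology on matrices is the product topology of the function type, that is, entrywise
  convergence.
\<close>

definition haar_measure :: "'i set \<Rightarrow> 'i cvec set \<Rightarrow> ('i, 'i) cmat measure \<Rightarrow> bool" where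
  "haar_measure B H \<mu> \<longleftrightarrow>
     prob_space \<mu> \<and>
     space \<mu> = unitary_group B H \<and>
     sets \<mu> = sets (restrict_space borel (unitary_group B H)) \<and>
     (\<forall>V\<in>unitary_group B H. distr \<mu> \<mu> (\<lambda>U. mat_mul B V U) = \<mu>)"

definition unit_vector :: "'i set \<Rightarrow> 'i cvec set \<Rightarrow> 'i cvec \<Rightarrow> bool" where
  "unit_vector B H v \<longleftrightarrow> v \<in> H \<and> cinner B v v = 1"

definition rho34 :: "nat \<Rightarrow> nat \<Rightarrow> quad cvec \<Rightarrow> (nat \<times> nat, nat \<times> nat) cmat" where
  "rho34 a b v = partial_trace_fst (pair_ix a b) (ket_bra v)"

definition Z1 :: "nat \<Rightarrow> nat \<Rightarrow> nat \<Rightarrow> nat \<Rightarrow> quad cvec \<Rightarrow> complex" where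
  "Z1 a b c d v =
     mat_trace (pair_ix c d) (mat_mul (pair_ix c d) (rho34 a b v) (rho34 a b v))"

definition Z0 :: "nat \<Rightarrow> nat \<Rightarrow> nat \<Rightarrow> nat \<Rightarrow> quad cvec \<Rightarrow> complex" where
  "Z0 a b c d v = (mat_trace (pair_ix c d) (rho34 a b v))\<^sup>2"

text \<open>The average of \<open>f |I\<rangle>\<close> over \<open>|I\<rangle> = U |0\<rangle>\<close>, where \<open>U\<close> has distribution \<open>\<mu>\<close> and \<open>v0 = |0\<rangle>\<close>.\<close>

definition haar_avg ::
    "'i set \<Rightarrow> ('i, 'i) cmat measure \<Rightarrow> 'i cvec \<Rightarrow> ('i cvec \<Rightarrow> complex) \<Rightarrow> complex" where
  "haar_avg B \<mu> v0 f = (\<integral>U. f (mat_app B U v0) \<partial>\<mu>)"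

definition avg_Z1 ::
    "nat \<Rightarrow> nat \<Rightarrow> nat \<Rightarrow> nat \<Rightarrow> (quad, quad) cmat measure \<Rightarrow> quad cvec \<Rightarrow> complex" where
  "avg_Z1 a b c d \<mu> v0 = haar_avg (quad_ix a b c d) \<mu> v0 (Z1 a b c d)"

definition avg_Z0 ::
    "nat \<Rightarrow> nat \<Rightarrow> nat \<Rightarrow> nat \<Rightarrow> (quad, quad) cmat measure \<Rightarrow> quad cvec \<Rightarrow> complex" where
  "avg_Z0 a b c d \<mu> v0 = haar_avg (quad_ix a b c d) \<mu> v0 (Z0 a b c d)"

text \<open>
  Both averages are real, as traces of Hermitian matrices; \<open>Re\<close> only changes the type.
\<close>

definition avg_S2 ::
    "nat \<Rightarrow> nat \<Rightarrow> nat \<Rightarrow> nat \<Rightarrow> (quad, quad) cmat measure \<Rightarrow> quad cvec \<Rightarrow> real" where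
  "avg_S2 a b c d \<mu> v0 = - ln (Re (avg_Z1 a b c d \<mu> v0 / avg_Z0 a b c d \<mu> v0))"

definition haar_setup ::
    "nat \<Rightarrow> nat \<Rightarrow> nat \<Rightarrow> nat \<Rightarrow> (quad, quad) cmat measure \<Rightarrow> quad cvec \<Rightarrow> bool" where
  "haar_setup a b c d \<mu> v0 \<longleftrightarrow>
     haar_measure (quad_ix a b c d) (H_inv a b c d) \<mu> \<and>
     unit_vector (quad_ix a b c d) (H_inv a b c d) v0"

end

theory Submission
  imports Defs "HOL-Real_Asymp.Real_Asymp"
begin

text \<open>
  The matrix \<open>spin_rep n g\<close> maps the coherent state \<open>w\<^sup>\<otimes>\<^sup>n\<close> to \<open>(g w)\<^sup>\<otimes>\<^sup>n\<close>, and the coherent states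
  separate vectors, so identities between intertwiners become identities between polynomials in a
  few points of \<open>\<complex>\<^sup>2\<close>.  In particular Schur's lemma follows from the diagonal torus and the
  transitivity of \<open>SU(2)\<close> on unit vectors, and the coupling of \<open>V\<^sub>n\<close> into \<open>V\<^sub>a \<otimes> V\<^sub>b\<close>,
  \<open>n = a + b - 2 k\<close>, has the generating function
  \<open>(x \<cdot> w)\<^sup>a\<^sup>-\<^sup>k (y \<cdot> w)\<^sup>b\<^sup>-\<^sup>k (x \<and> y)\<^sup>k\<close>.

  Hence the invariant subspace has an orthonormal basis indexed by the intermediate spins,
  consisting of the maximally entangled vectors in \<open>V\<^sub>n \<otimes> V\<^sub>n\<close>.  Their reduced density matrices are
  \<open>P\<^sub>n / (n + 1)\<close> with mutually orthogonal projections \<open>P\<^sub>n\<close> of rank \<open>n + 1\<close>, so a vector with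
  coordinates \<open>x\<^sub>n\<close> has purity \<open>\<Sum>\<^sub>n |x\<^sub>n|\<^sup>4 / (n + 1)\<close>.  Finally, invariance of the Haar measure under
  reflections gives the fourth moment \<open>2 / (D\<^sup>2 + D)\<close> of each coordinate in dimension \<open>D\<close>.
\<close>

section \<open>Matrices indexed by finite sets\<close>

text \<open>The transpose is taken without conjugation because all pairings with coherent states are
  bilinear; on the real coupling matrices below it coincides with the adjoint.\<close>

definition mtr :: "('i, 'k) cmat \<Rightarrow> ('k, 'i) cmat" where
  "mtr A = (\<lambda>i k. A k i)"

definition mid :: "'i set \<Rightarrow> ('i, 'i) cmat" where
  "mid B = (\<lambda>i k. if i = k \<and> i \<in> B then 1 else 0)"

text \<open>Matrices are total functions, so an equality of matrices also speaks about entries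
  outside the index sets; this predicate pins those entries to 0.\<close>

definition msupp :: "'i set \<Rightarrow> 'k set \<Rightarrow> ('i, 'k) cmat \<Rightarrow> bool" where
  "msupp B C A \<longleftrightarrow> (\<forall>i k. i \<notin> B \<or> k \<notin> C \<longrightarrow> A i k = 0)"

definition mscale :: "complex \<Rightarrow> ('i, 'k) cmat \<Rightarrow> ('i, 'k) cmat" where
  "mscale c A = (\<lambda>i k. c * A i k)"

lemma mat_mul_assoc:
  "mat_mul C (mat_mul B X Y) Z = mat_mul B X (mat_mul C Y Z)"
proof (intro ext)
  fix i l
  have "mat_mul C (mat_mul B X Y) Z i l = (\<Sum>c\<in>C. \<Sum>b\<in>B. X i b * (Y b c * Z c l))"
    by (simp add: mat_mul_def sum_distrib_right mult.assoc)
  also have "\<dots> = (\<Sum>b\<in>B. \<Sum>c\<in>C. X i b * (Y b c * Z c l))"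
    by (rule sum.swap)
  also have "\<dots> = mat_mul B X (mat_mul C Y Z) i l"
    by (simp add: mat_mul_def sum_distrib_left)
  finally show "mat_mul C (mat_mul B X Y) Z i l = mat_mul B X (mat_mul C Y Z) i l" .
qed

lemma mtr_mat_mul: "mtr (mat_mul B X Y) = mat_mul B (mtr Y) (mtr X)"
  by (simp add: mtr_def mat_mul_def mult.commute)

lemma mtr_mtr [simp]: "mtr (mtr X) = X"
  by (simp add: mtr_def)

lemma mtr_mid [simp]: "mtr (mid B) = mid B"
  by (auto simp: mtr_def mid_def fun_eq_iff)

lemma mtr_zero [simp]: "mtr (\<lambda>i k. 0) = (\<lambda>i k. 0)"
  by (simp add: mtr_def)

lemma mat_mul_zero [simp]:
  "mat_mul B (\<lambda>i k. 0) X = (\<lambda>i k. 0)" "mat_mul B Y (\<lambda>i k. 0) = (\<lambda>i k. 0)"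
  by (simp_all add: mat_mul_def)

lemma mat_mul_mscale [simp]:
  "mat_mul B (mscale c X) Y = mscale c (mat_mul B X Y)"
  "mat_mul B X (mscale c Y) = mscale c (mat_mul B X Y)"
  by (simp_all add: mat_mul_def mscale_def sum_distrib_left mult_ac)

lemma mtr_mscale [simp]: "mtr (mscale c X) = mscale c (mtr X)"
  by (simp add: mtr_def mscale_def)

lemma mscale_mscale [simp]: "mscale c (mscale d X) = mscale (c * d) X"
  by (simp add: mscale_def mult.assoc)

lemma mscale_1 [simp]: "mscale 1 X = X"
  by (simp add: mscale_def)

lemma mscale_0 [simp]: "mscale 0 X = (\<lambda>i k. 0)"
  by (simp add: mscale_def)

lemma mat_mul_mid_left:
  assumes "finite B" "msupp B C X"
  shows "mat_mul B (mid B) X = X"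
proof (intro ext)
  fix i k
  have "mat_mul B (mid B) X i k = (\<Sum>b\<in>B. if i = b then X b k else 0)"
    unfolding mat_mul_def mid_def by (rule sum.cong) auto
  also have "\<dots> = X i k"
    using assms by (auto simp: msupp_def)
  finally show "mat_mul B (mid B) X i k = X i k" .
qed

lemma msupp_mtr [simp]: "msupp C B (mtr X) \<longleftrightarrow> msupp B C X"
  by (auto simp: msupp_def mtr_def)

lemma mat_mul_mid_right:
  assumes "finite C" "msupp B C X"
  shows "mat_mul C X (mid C) = X"
  using mat_mul_mid_left[of C B "mtr X"] assms
  by (metis msupp_mtr mtr_mat_mul mtr_mid mtr_mtr)

lemma msupp_mat_mul: "msupp B C X \<Longrightarrow> msupp C D Y \<Longrightarrow> msupp B D (mat_mul C X Y)"
  by (auto simp: msupp_def mat_mul_def)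

lemma msupp_mscale: "msupp B C X \<Longrightarrow> msupp B C (mscale c X)"
  by (auto simp: msupp_def mscale_def)

lemma mat_mul_sum_left: "mat_mul B (\<lambda>i k. \<Sum>s\<in>S. X s i k) Y = (\<lambda>i k. \<Sum>s\<in>S. mat_mul B (X s) Y i k)"
  by (intro ext) (simp add: mat_mul_def sum_distrib_right, rule sum.swap)

lemma mat_mul_sum_right: "mat_mul B X (\<lambda>i k. \<Sum>s\<in>S. Y s i k) = (\<lambda>i k. \<Sum>s\<in>S. mat_mul B X (Y s) i k)"
  by (intro ext) (simp add: mat_mul_def sum_distrib_left, rule sum.swap)

section \<open>Coherent states\<close>

definition cdot :: "complex^2 \<Rightarrow> complex^2 \<Rightarrow> complex" where
  "cdot z w = z $ 1 * w $ 1 + z $ 2 * w $ 2"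

definition wedge :: "complex^2 \<Rightarrow> complex^2 \<Rightarrow> complex" where
  "wedge z w = z $ 1 * w $ 2 - z $ 2 * w $ 1"

lemma mv2: "(g *v w) $ i = g $ i $ 1 * w $ 1 + g $ i $ 2 * w $ (2::2)"
  for g :: "complex^2^2"
  by (simp add: matrix_vector_mult_def sum_2)

lemma cdot_transpose: "cdot z (g *v w) = cdot (transpose g *v z) w"
  by (simp add: cdot_def mv2 transpose_def algebra_simps)

lemma wedge_det: "wedge (g *v z) (g *v w) = det g * wedge z w"
  by (simp add: wedge_def mv2 det_2 algebra_simps)

text \<open>These are the components of the n-th tensor power of \<open>w\<close> in the orthonormal
  basis behind \<open>spin_rep\<close>. The root of the binomial makes the bilinear pairing of two
  such vectors a power of \<open>cdot\<close>.\<close>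

definition coh :: "nat \<Rightarrow> complex^2 \<Rightarrow> nat \<Rightarrow> complex" where
  "coh n w k = (if k \<le> n
     then complex_of_real (sqrt (real (n choose k))) * w $ 1 ^ k * w $ 2 ^ (n - k) else 0)"

lemma of_real_sqrt_binomial_square:
  "complex_of_real (sqrt (real (n choose k))) * complex_of_real (sqrt (real (n choose k)))
    = of_nat (n choose k)"
  by (metis abs_of_nat of_real_mult of_real_of_nat_eq real_sqrt_mult_self)

lemma coh_sum: "(\<Sum>k\<le>n. coh n z k * coh n w k) = cdot z w ^ n"
proof -
  note of_real_sqrt_binomial_square[of n]
  then have "coh n z k * coh n w k
      = of_nat (n choose k) * (z $ 1 * w $ 1) ^ k * (z $ 2 * w $ 2) ^ (n - k)" if "k \<le> n" for k
    using that by (simp add: coh_def power_mult_distrib algebra_simps)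
  then show ?thesis
    by (simp add: cdot_def binomial_ring)
qed

text \<open>With \<open>p\<close> and \<open>q\<close> the dehomogenised images of the two basis
  vectors, the binomial theorem identifies the sum with a coefficient of (w_1 p + w_2 q)^n. The
  linear polynomial inside the power is the dehomogenised vector g w.\<close>

lemma spin_rep_coh: "(\<Sum>m\<le>n. spin_rep n g k m * coh n w m) = coh n (g *v w) k"
proof (cases "k \<le> n")
  case True
  define p where "p = [:g $ 2 $ 1, g $ 1 $ 1:]"
  define q where "q = [:g $ 2 $ 2, g $ 1 $ 2:]"
  define s where "s k = complex_of_real (sqrt (real (n choose k)))" for k
  have s2: "s k * s k = of_nat (n choose k)" for k
    unfolding s_def by (rule of_real_sqrt_binomial_square)
  have sk: "s k \<noteq> 0" using True by (simp add: s_def)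
  have *: "spin_rep n g k m * coh n w m
      = inverse (s k) * coeff (of_nat (n choose m) * (smult (w $ 1) p) ^ m * (smult (w $ 2) q) ^ (n - m)) k"
    if "m \<le> n" for m
  proof -
    have "of_nat (n choose m) * smult (w $ 1) p ^ m * smult (w $ 2) q ^ (n - m)
        = smult (of_nat (n choose m) * w $ 1 ^ m * w $ 2 ^ (n - m)) (p ^ m * q ^ (n - m))"
      by (simp add: smult_power of_nat_poly mult_ac)
    moreover have "spin_rep n g k m * coh n w m =
        inverse (s k) * (s m * s m) * w $ 1 ^ m * w $ 2 ^ (n - m) * coeff (p ^ m * q ^ (n - m)) k"
      using that True by (simp add: spin_rep_def coh_def p_def q_def s_def real_sqrt_divide field_simps)
    ultimately show ?thesis by (simp add: s2)
  qed
  have "(\<Sum>m\<le>n. spin_rep n g k m * coh n w m)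
      = inverse (s k) * coeff (\<Sum>m\<le>n. of_nat (n choose m) * (smult (w $ 1) p) ^ m * (smult (w $ 2) q) ^ (n - m)) k"
    by (simp add: * coeff_sum sum_distrib_left)
  also have "(\<Sum>m\<le>n. of_nat (n choose m) * (smult (w $ 1) p) ^ m * (smult (w $ 2) q) ^ (n - m))
      = [:(g *v w) $ 2, (g *v w) $ 1:] ^ n"
    by (subst binomial_ring[symmetric]) (simp add: p_def q_def mv2 mult.commute)
  also have "coeff \<dots> k = of_nat (n choose k) * (g *v w) $ 1 ^ k * (g *v w) $ 2 ^ (n - k)"
    using True by (simp add: coeff_linear_poly_power)
  also have "inverse (s k) * \<dots> = coh n (g *v w) k"
    using True sk by (simp add: coh_def flip: s_def s2)
  finally show ?thesis .
qed (simp add: spin_rep_def coh_def)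

text \<open>At the points (x, 1) the pairing is a polynomial in x whose coefficients are the numbers
  \<open>v k\<close> times nonzero roots. A polynomial that vanishes everywhere has only zero
  coefficients.\<close>

lemma coh_separating:
  assumes "\<And>z. (\<Sum>k\<le>n. v k * coh n z k) = 0" and "k \<le> n"
  shows "v k = 0"
proof -
  define p where "p = (\<Sum>k\<le>n. monom (v k * complex_of_real (sqrt (real (n choose k)))) k)"
  have "poly p x = 0" for x
    using assms(1)[of "vector [x, 1]"] by (simp add: p_def poly_sum poly_monom coh_def mult_ac)
  then have "p = 0"
    by (metis poly_all_0_iff_0)
  then have "coeff p k = 0" by simp
  then show ?thesis
    using assms(2) by (simp add: p_def coeff_sum if_distrib cong: if_cong)
qed

text \<open>A vector as a matrix with one column, so that bilinear forms become matrix products.\<close>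

definition ccol :: "nat \<Rightarrow> complex^2 \<Rightarrow> (nat, unit) cmat" where
  "ccol n w = (\<lambda>k _. coh n w k)"

definition cform :: "nat \<Rightarrow> nat \<Rightarrow> (nat, nat) cmat \<Rightarrow> complex^2 \<Rightarrow> complex^2 \<Rightarrow> complex" where
  "cform m n N z w = mat_mul {..m} (mtr (ccol m z)) (mat_mul {..n} N (ccol n w)) () ()"

lemma cform_sum: "cform m n N z w = (\<Sum>i\<le>m. \<Sum>j\<le>n. coh m z i * N i j * coh n w j)"
  by (simp add: cform_def mat_mul_def mtr_def ccol_def sum_distrib_left mult.assoc)

text \<open>Coherent states are separated first in \<open>w\<close> and then in \<open>z\<close>;
  the support hypotheses settle the entries outside the index ranges.\<close>

lemma cform_eqI:
  assumes "\<And>z w. cform m n N z w = cform m n N' z w"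
    and "msupp {..m} {..n} N" "msupp {..m} {..n} N'"
  shows "N = N'"
proof (intro ext)
  fix i j
  show "N i j = N' i j"
  proof (cases "i \<le> m \<and> j \<le> n")
    case True
    have "(\<Sum>j\<le>n. (\<Sum>i\<le>m. coh m z i * (N i j - N' i j)) * coh n w j) = 0" for z w
      using assms(1)[of z w] unfolding cform_sum
      by (subst (asm) (1 2) sum.swap)
        (simp add: sum_distrib_left sum_distrib_right algebra_simps sum_subtractf)
    then have "(\<Sum>i\<le>m. coh m z i * (N i j - N' i j)) = 0" for z
      by (rule coh_separating) (use True in auto)
    then have "N i j - N' i j = 0"
      by (intro coh_separating[where n = m and v = "\<lambda>i. N i j - N' i j"])
        (use True in \<open>auto simp: mult.commute\<close>)
    then show ?thesis by simp
  next
    case False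
    then show ?thesis using assms(2,3) by (auto simp: msupp_def)
  qed
qed

lemma spin_rep_ccol: "mat_mul {..n} (spin_rep n g) (ccol n w) = ccol n (g *v w)"
  by (simp add: mat_mul_def ccol_def spin_rep_coh)

lemma cform_spin_rep: "cform n n (spin_rep n g) z w = cdot z (g *v w) ^ n"
  unfolding cform_def spin_rep_ccol by (simp add: mat_mul_def mtr_def ccol_def coh_sum)

lemma cform_mtr: "cform m n (mtr N) z w = cform n m N w z"
  unfolding cform_sum by (subst sum.swap) (simp add: mtr_def mult_ac)

lemma msupp_spin_rep [simp]: "msupp {..n} {..n} (spin_rep n g)"
  by (auto simp: msupp_def spin_rep_def)

text \<open>Both sides have the generating function (z . g^T w)^n.\<close>

lemma spin_rep_transpose: "mtr (spin_rep n g) = spin_rep n (transpose g)"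
  by (rule cform_eqI[where m = n and n = n])
    (simp_all add: cform_mtr cform_spin_rep cdot_transpose, simp add: cdot_def mult.commute)

text \<open>The action N -> g N g^T on bilinear forms becomes a change of variables by g^T, which
  turns invariance of a form into a polynomial identity.\<close>

lemma cform_sandwich:
  "cform m n (mat_mul {..m} (spin_rep m g) (mat_mul {..n} N (mtr (spin_rep n g)))) z w
    = cform m n N (transpose g *v z) (transpose g *v w)"
proof -
  have "mat_mul {..m} (mtr (ccol m z)) (spin_rep m g) = mtr (ccol m (transpose g *v z))"
    by (metis mtr_mat_mul mtr_mtr spin_rep_ccol spin_rep_transpose)
  then show ?thesis
    unfolding cform_def
    by (simp add: mat_mul_assoc spin_rep_transpose spin_rep_ccol flip: mat_mul_assoc[of _ _ "mtr (ccol m z)"])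
qed

section \<open>Schur's lemma for the spin representations\<close>

definition su2_mat :: "complex \<Rightarrow> complex \<Rightarrow> complex^2^2" where
  "su2_mat a b = vector [vector [a, - cnj b], vector [b, cnj a]]"

lemma su2_mat_in_SU2:
  assumes "a * cnj a + b * cnj b = 1"
  shows "su2_mat a b \<in> SU2"
  using assms
  by (auto simp: SU2_def su2_mat_def det_2 vec_eq_iff matrix_matrix_mult_def sum_2 forall_2
      transpose_def map_matrix_def mat_def algebra_simps)

lemma SU2_transpose:
  assumes "g \<in> SU2"
  shows "transpose g \<in> SU2"
proof -
  have "transpose (map_matrix cnj g) ** g = mat 1"
    using assms by (simp add: SU2_def matrix_left_right_inverse)
  then have "transpose (transpose (map_matrix cnj g) ** g) = mat 1"
    by simp
  moreover have "transpose (transpose (map_matrix cnj g) ** g)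
      = transpose g ** transpose (map_matrix cnj (transpose g))"
    by (simp add: vec_eq_iff matrix_matrix_mult_def sum_2 transpose_def map_matrix_def mult.commute)
  ultimately show ?thesis
    using assms by (simp add: SU2_def det_transpose)
qed

lemma SU2_det: "g \<in> SU2 \<Longrightarrow> det g = 1"
  by (simp add: SU2_def)

lemma SU2_surj:
  assumes "g \<in> SU2"
  obtains v where "w = g *v v"
proof
  show "w = g *v (transpose (map_matrix cnj g) *v w)"
    using assms by (simp add: SU2_def matrix_vector_mul_assoc del: transpose_matrix_vector)
qed

definition e1 :: "complex^2" where
  "e1 = vector [1, 0]"

text \<open>Every unit vector is the first column of a matrix in SU(2), so a nonzero
  \<open>z\<close> is divided by its norm; for \<open>z = 0\<close> the scalar is 0.\<close>

lemma SU2_reach: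
  obtains c g where "g \<in> SU2" "z = c *s (g *v e1)"
proof (cases "z = 0")
  case True
  have "su2_mat 1 0 \<in> SU2" by (rule su2_mat_in_SU2) simp
  then show ?thesis using that[of "su2_mat 1 0" 0] True by simp
next
  case False
  define r where "r = sqrt ((cmod (z $ 1))\<^sup>2 + (cmod (z $ 2))\<^sup>2)"
  have "z $ 1 \<noteq> 0 \<or> z $ 2 \<noteq> 0"
    using False by (auto simp: vec_eq_iff forall_2)
  then have r: "r > 0"
    by (auto simp: r_def intro: add_pos_nonneg add_nonneg_pos)
  have "complex_of_real (r\<^sup>2) = z $ 1 * cnj (z $ 1) + z $ 2 * cnj (z $ 2)"
    by (simp add: r_def complex_norm_square flip: of_real_power)
  moreover have "complex_of_real (r\<^sup>2) \<noteq> 0" using r by simp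
  ultimately have "su2_mat (z $ 1 / of_real r) (z $ 2 / of_real r) \<in> SU2"
    by (intro su2_mat_in_SU2)
      (simp add: power2_eq_square flip: add_divide_distrib)
  moreover have "z = of_real r *s (su2_mat (z $ 1 / of_real r) (z $ 2 / of_real r) *v e1)"
    using r by (simp add: vec_eq_iff forall_2 mv2 su2_mat_def e1_def)
  ultimately show ?thesis by (rule that)
qed

text \<open>This is the invariant bilinear form of the spin representation: up to sign, the n-th
  symmetric power of the area form \<open>wedge\<close> on the plane.\<close>

definition epsm :: "nat \<Rightarrow> (nat, nat) cmat" where
  "epsm n = (\<lambda>k l. if k + l = n then (-1) ^ k else 0)"

lemma msupp_epsm [simp]: "msupp {..n} {..n} (epsm n)"
  by (auto simp: msupp_def epsm_def)

lemma epsm_right: "k \<le> n \<Longrightarrow> (\<Sum>l\<le>n. epsm n k l * f l) = (-1) ^ k * f (n - k)"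
proof -
  assume "k \<le> n"
  then have "epsm n k l * f l = (if l = n - k then (-1) ^ k * f (n - k) else 0)" for l
    by (auto simp: epsm_def)
  then show ?thesis by simp
qed

lemma epsm_mtr: "mat_mul {..n} (epsm n) (mtr (epsm n)) = mid {..n}"
proof (intro ext)
  fix i k
  show "mat_mul {..n} (epsm n) (mtr (epsm n)) i k = mid {..n} i k"
  proof (cases "i \<le> n")
    case True
    then show ?thesis
      unfolding mat_mul_def mtr_def epsm_right[OF True]
      by (auto simp: mid_def epsm_def simp flip: power_add mult_2)
  next
    case False
    then show ?thesis by (simp add: mat_mul_def mid_def epsm_def)
  qed
qed

text \<open>This is the dichotomy between integer spins, whose invariant form is symmetric, and
  half-integer spins, where it is antisymmetric.\<close>

lemma mtr_epsm: "mtr (epsm n) = mscale ((-1) ^ n) (epsm n)"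
proof (intro ext)
  fix i k
  have "(-1) ^ k = (-1) ^ (i + k) * (-1 :: complex) ^ i"
    by (cases "even i"; cases "even k"; simp)
  then show "mtr (epsm n) i k = mscale ((-1) ^ n) (epsm n) i k"
    by (simp add: mtr_def mscale_def epsm_def add.commute)
qed

lemma mtr_epsm_epsm: "mat_mul {..n} (mtr (epsm n)) (epsm n) = mid {..n}"
  using epsm_mtr[of n] by (simp add: mtr_epsm)

lemma cform_epsm: "cform n n (epsm n) z w = (- wedge z w) ^ n"
proof -
  note of_real_sqrt_binomial_square[of n]
  then have "coh n z k * ((-1) ^ k * coh n w (n - k))
      = of_nat (n choose k) * (- (z $ 1 * w $ 2)) ^ k * (z $ 2 * w $ 1) ^ (n - k)" if "k \<le> n" for k
    using that
    by (subst power_minus) (simp add: coh_def power_mult_distrib algebra_simps flip: binomial_symmetric)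
  moreover have "- wedge z w = - (z $ 1 * w $ 2) + z $ 2 * w $ 1"
    by (simp add: wedge_def)
  ultimately show ?thesis
    by (simp only: binomial_ring cform_sum)
      (simp add: mult.assoc epsm_right flip: sum_distrib_left)
qed

text \<open>The generating function is a power of \<open>wedge\<close>, and \<open>wedge\<close> is
  multiplied by the determinant, which is 1.\<close>

lemma spin_rep_epsm:
  assumes "g \<in> SU2"
  shows "mat_mul {..n} (spin_rep n g) (mat_mul {..n} (epsm n) (mtr (spin_rep n g))) = epsm n"
  using SU2_transpose[OF assms, THEN SU2_det]
  by (intro cform_eqI[where m = n and n = n])
    (simp_all add: cform_sandwich cform_epsm wedge_det msupp_mat_mul[where C = "{..n}"]
      del: transpose_matrix_vector)

lemma coh_scale: "coh n (c *s w) k = c ^ n * coh n w k"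
  by (auto simp: coh_def power_mult_distrib simp flip: power_add)

lemma cform_scale_left: "cform m n N (c *s z) w = c ^ m * cform m n N z w"
  by (simp add: cform_sum coh_scale sum_distrib_left mult.assoc)

lemma coh_e1: "coh m e1 i = (if i = m then 1 else 0)"
  by (auto simp: coh_def e1_def power_0_left)

lemma cform_e1: "cform m n N e1 w = (\<Sum>j\<le>n. N m j * coh n w j)"
proof -
  have "cform m n N e1 w = (\<Sum>i\<le>m. if i = m then (\<Sum>j\<le>n. N m j * coh n w j) else 0)"
    unfolding cform_sum coh_e1 by (rule sum.cong) auto
  then show ?thesis by simp
qed

text \<open>Setting \<open>z = e1\<close> isolates the row \<open>m\<close> of \<open>N\<close>. The
  diagonal torus kills each of its entries of nonzero weight m + 2j - n; as
  \<open>n \<le> m\<close>, weight 0 occurs only for m = n and j = 0. Transitivity of SU(2) on unit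
  vectors then carries the formula from \<open>e1\<close> to all \<open>z\<close>.\<close>

lemma schur_form_le:
  assumes supp: "msupp {..m} {..n} N" and "n \<le> m"
    and inv: "\<And>g. g \<in> SU2 \<Longrightarrow>
      mat_mul {..m} (spin_rep m g) (mat_mul {..n} N (mtr (spin_rep n g))) = N"
  shows "\<exists>c. N = (if m = n then mscale c (epsm n) else (\<lambda>i j. 0))"
proof -
  have f: "cform m n N (h *v z) (h *v w) = cform m n N z w" if "h \<in> SU2" for h z w
    using cform_sandwich[of m n "transpose h" N z w] inv[OF SU2_transpose[OF that]] by simp
  have zero: "N m j = 0" if "j \<le> n" "m + j \<noteq> n - j" for j
  proof -
    define d where "d = m + j - (n - j)"
    have d: "d > 0" "m + j = d + (n - j)" using that \<open>n \<le> m\<close> by (auto simp: d_def)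
    \<comment> \<open>The torus element multiplies the entry by u^d. This angle gives u^d = -1, so
      the factor u^d - 1 is nonzero.\<close>
    define u where "u = cis (pi / d)"
    have uu: "u * cnj u = 1" by (simp add: u_def cis_cnj cis_mult)
    have ud: "u ^ d = -1" unfolding u_def Complex.DeMoivre using d by simp
    have h: "su2_mat u 0 \<in> SU2" by (rule su2_mat_in_SU2) (simp add: uu)
    have 1: "su2_mat u 0 *v e1 = u *s e1"
      by (simp add: vec_eq_iff forall_2 mv2 su2_mat_def e1_def)
    have 2: "coh n (su2_mat u 0 *v w) k = u ^ k * cnj u ^ (n - k) * coh n w k" for w k
      by (simp add: coh_def mv2 su2_mat_def power_mult_distrib)
    have "(\<Sum>j\<le>n. (u ^ m * u ^ j * cnj u ^ (n - j) - 1) * N m j * coh n w j) = 0" for w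
      using f[OF h, of e1 w] unfolding 1 cform_scale_left cform_e1 2
      by (simp add: algebra_simps sum_subtractf sum_distrib_left)
    then have "(u ^ m * u ^ j * cnj u ^ (n - j) - 1) * N m j = 0"
      using \<open>j \<le> n\<close> by (rule coh_separating)
    moreover have "u ^ m * u ^ j * cnj u ^ (n - j) = u ^ d * (u * cnj u) ^ (n - j)"
      by (simp add: d(2) power_mult_distrib flip: power_add)
    ultimately show ?thesis by (simp add: uu ud)
  qed
  \<comment> \<open>Only the corner entry survives. Putting c = 0 for unequal spins also reconciles
    the powers a^m and a^n when \<open>z\<close> is rescaled below.\<close>
  define c where "c = (if m = n then N m 0 else 0)"
  have e1: "cform m n N e1 w = c * wedge e1 w ^ n" for w
  proof -
    have "cform m n N e1 w = (\<Sum>j\<le>n. if j = 0 then c * coh n w 0 else 0)"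
      unfolding cform_e1 by (rule sum.cong) (use zero \<open>n \<le> m\<close> in \<open>auto simp: c_def\<close>)
    then show ?thesis
      by (simp add: coh_def wedge_def e1_def)
  qed
  have gen: "cform m n N z w = c * wedge z w ^ n" for z w
  proof -
    obtain a g where g: "g \<in> SU2" and z: "z = a *s (g *v e1)" by (rule SU2_reach)
    obtain v where w: "w = g *v v" using g by (rule SU2_surj)
    have "wedge z w = a * wedge (g *v e1) w"
      by (simp add: z wedge_def algebra_simps)
    also have "\<dots> = a * wedge e1 v"
      by (simp add: w wedge_det SU2_det g)
    finally have "wedge z w = a * wedge e1 v" .
    moreover have "cform m n N z w = a ^ m * (c * wedge e1 v ^ n)"
      unfolding z cform_scale_left by (simp add: w f g e1)
    ultimately show ?thesis
      by (auto simp: c_def power_mult_distrib)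
  qed
  have "N = (if m = n then mscale (c * (-1) ^ n) (epsm n) else (\<lambda>i j. 0))"
  proof (rule cform_eqI)
    fix z w
    have "cform n n (mscale (c * (-1) ^ n) (epsm n)) z w = c * (-1) ^ n * cform n n (epsm n) z w"
      by (simp add: cform_sum mscale_def sum_distrib_left mult_ac)
    also have "\<dots> = c * wedge z w ^ n"
      by (subst cform_epsm, subst power_minus) (simp add: mult.assoc flip: mult.assoc[of "(-1) ^ n"])
    finally show "cform m n N z w
        = cform m n (if m = n then mscale (c * (-1) ^ n) (epsm n) else (\<lambda>i j. 0)) z w"
      using gen[of z w] by (auto simp: c_def cform_sum)
  qed (use supp in \<open>auto intro: msupp_mscale simp: msupp_def[of _ _ "\<lambda>i j. 0"]\<close>)
  then show ?thesis by blast
qed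

text \<open>For m < n the transposed form has the larger spin on the left, so the previous lemma
  makes it vanish.\<close>

lemma schur_form:
  assumes supp: "msupp {..m} {..n} N"
    and inv: "\<And>g. g \<in> SU2 \<Longrightarrow>
      mat_mul {..m} (spin_rep m g) (mat_mul {..n} N (mtr (spin_rep n g))) = N"
  shows "\<exists>c. N = (if m = n then mscale c (epsm n) else (\<lambda>i j. 0))"
proof (cases "n \<le> m")
  case True
  then show ?thesis using schur_form_le[OF supp] inv by blast
next
  case False
  have "mat_mul {..n} (spin_rep n g) (mat_mul {..m} (mtr N) (mtr (spin_rep m g))) = mtr N"
    if "g \<in> SU2" for g
    using arg_cong[OF inv[OF that], of mtr] by (simp add: mtr_mat_mul mat_mul_assoc)
  then have "mtr N = (\<lambda>i j. 0)"
    using schur_form_le[of n m "mtr N"] supp False by auto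
  then have "N = (\<lambda>i j. 0)"
    by (metis mtr_mtr mtr_zero)
  then show ?thesis using False by auto
qed

text \<open>Composing with the invariant form \<open>epsm\<close> turns an intertwiner into an
  invariant bilinear form. Nothing is lost, since \<open>epsm\<close> times its transpose is the
  identity.\<close>

lemma schur_equivariant:
  assumes supp: "msupp {..m} {..n} A"
    and eqv: "\<And>g. g \<in> SU2 \<Longrightarrow> mat_mul {..n} A (spin_rep n g) = mat_mul {..m} (spin_rep m g) A"
  shows "\<exists>c. A = (if m = n then mscale c (mid {..n}) else (\<lambda>i j. 0))"
proof -
  have A: "A = mat_mul {..n} (mat_mul {..n} A (epsm n)) (mtr (epsm n))"
    by (simp add: mat_mul_assoc epsm_mtr mat_mul_mid_right[OF _ supp])
  have "\<exists>c. mat_mul {..n} A (epsm n) = (if m = n then mscale c (epsm n) else (\<lambda>i j. 0))"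
  proof (rule schur_form)
    fix g assume g: "g \<in> SU2"
    have "mat_mul {..m} (spin_rep m g) (mat_mul {..n} (mat_mul {..n} A (epsm n)) (mtr (spin_rep n g)))
        = mat_mul {..n} (mat_mul {..m} (spin_rep m g) A) (mat_mul {..n} (epsm n) (mtr (spin_rep n g)))"
      by (simp only: mat_mul_assoc)
    also have "\<dots> = mat_mul {..n} A (mat_mul {..n} (spin_rep n g) (mat_mul {..n} (epsm n) (mtr (spin_rep n g))))"
      by (simp only: eqv[OF g, symmetric] mat_mul_assoc)
    finally show "mat_mul {..m} (spin_rep m g)
        (mat_mul {..n} (mat_mul {..n} A (epsm n)) (mtr (spin_rep n g))) = mat_mul {..n} A (epsm n)"
      by (simp add: spin_rep_epsm g)
  qed (use supp in \<open>auto intro: msupp_mat_mul\<close>)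
  then obtain c where "mat_mul {..n} A (epsm n) = (if m = n then mscale c (epsm n) else (\<lambda>i j. 0))"
    by blast
  then have "A = (if m = n then mscale c (mid {..n}) else (\<lambda>i j. 0))"
    using A by (auto simp: epsm_mtr)
  then show ?thesis by blast
qed

section \<open>The Clebsch--Gordan decomposition\<close>

lemma msupp_sum:
  "(\<And>t. t \<in> A \<Longrightarrow> msupp B C (X t)) \<Longrightarrow> msupp B C (\<lambda>i k. \<Sum>t\<in>A. X t i k)"
  by (simp add: msupp_def)

lemma finite_pair_ix [simp]: "finite (pair_ix a b)"
  by (simp add: pair_ix_def spin_ix_def)

lemma sum_pair_ix: "(\<Sum>p\<in>pair_ix a b. f p) = (\<Sum>i\<le>a. \<Sum>j\<le>b. f (i, j))"
  by (simp add: pair_ix_def spin_ix_def sum.cartesian_product)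

lemma msupp_pair_rep [simp]: "msupp (pair_ix a b) (pair_ix a b) (pair_rep a b g)"
  by (auto simp: msupp_def pair_rep_def kron_def pair_ix_def spin_ix_def spin_rep_def)

lemma pair_rep_transpose: "mtr (pair_rep a b g) = pair_rep a b (transpose g)"
  unfolding pair_rep_def spin_rep_transpose[symmetric]
  by (auto simp: mtr_def kron_def fun_eq_iff)

section \<open>Three-variable generating functions for maps into a product of two spins\<close>

definition pcol :: "nat \<Rightarrow> nat \<Rightarrow> complex^2 \<Rightarrow> complex^2 \<Rightarrow> (nat \<times> nat, unit) cmat" where
  "pcol a b x y = (\<lambda>(i, j) _. coh a x i * coh b y j)"

lemma pair_rep_pcol: "mat_mul (pair_ix a b) (pair_rep a b g) (pcol a b x y) = pcol a b (g *v x) (g *v y)"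
proof (intro ext)
  fix p :: "nat \<times> nat" and u
  obtain i j where p: "p = (i, j)" by (cases p)
  have "mat_mul (pair_ix a b) (pair_rep a b g) (pcol a b x y) p u
      = (\<Sum>k\<le>a. spin_rep a g i k * coh a x k) * (\<Sum>l\<le>b. spin_rep b g j l * coh b y l)"
    by (simp add: mat_mul_def sum_pair_ix p pair_rep_def kron_def pcol_def sum_product mult_ac)
  then show "mat_mul (pair_ix a b) (pair_rep a b g) (pcol a b x y) p u = pcol a b (g *v x) (g *v y) p u"
    by (simp add: spin_rep_coh p pcol_def)
qed

definition pform :: "nat \<Rightarrow> nat \<Rightarrow> nat \<Rightarrow> (nat \<times> nat, nat) cmat \<Rightarrow>
    complex^2 \<Rightarrow> complex^2 \<Rightarrow> complex^2 \<Rightarrow> complex" where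
  "pform a b n T x y w
    = mat_mul (pair_ix a b) (mtr (pcol a b x y)) (mat_mul {..n} T (ccol n w)) () ()"

lemma pform_sum: "pform a b n T x y w
    = (\<Sum>i\<le>a. \<Sum>j\<le>b. \<Sum>l\<le>n. coh a x i * coh b y j * T (i, j) l * coh n w l)"
  by (simp add: pform_def mat_mul_def mtr_def ccol_def pcol_def sum_pair_ix sum_distrib_left mult.assoc)

lemma pform_eqI:
  assumes "\<And>x y w. pform a b n T x y w = pform a b n T' x y w"
    and "msupp (pair_ix a b) {..n} T" "msupp (pair_ix a b) {..n} T'"
  shows "T = T'"
proof (intro ext)
  fix p :: "nat \<times> nat" and l
  obtain i j where p: "p = (i, j)" by (cases p)
  show "T p l = T' p l"
  proof (cases "i \<le> a \<and> j \<le> b \<and> l \<le> n")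
    case True
    define D where "D i j l = T (i, j) l - T' (i, j) l" for i j l
    have "(\<Sum>i\<le>a. (\<Sum>j\<le>b. (\<Sum>l\<le>n. D i j l * coh n w l) * coh b y j) * coh a x i) = 0" for x y w
    proof -
      have "(\<Sum>i\<le>a. (\<Sum>j\<le>b. (\<Sum>l\<le>n. D i j l * coh n w l) * coh b y j) * coh a x i)
          = pform a b n T x y w - pform a b n T' x y w"
        by (simp add: pform_sum D_def sum_distrib_left sum_distrib_right algebra_simps sum_subtractf)
      then show ?thesis using assms(1) by simp
    qed
    then have "(\<Sum>j\<le>b. (\<Sum>l\<le>n. D i j l * coh n w l) * coh b y j) = 0" for y w
      by (rule coh_separating[where n = a]) (use True in simp)
    then have "(\<Sum>l\<le>n. D i j l * coh n w l) = 0" for w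
      by (rule coh_separating[where n = b]) (use True in simp)
    then have "D i j l = 0"
      by (rule coh_separating[where n = n]) (use True in simp)
    then show ?thesis by (simp add: D_def p)
  next
    case False
    then show ?thesis
      using assms(2,3) by (auto simp: msupp_def pair_ix_def spin_ix_def p)
  qed
qed

lemma pform_pair_rep:
  "pform a b n (mat_mul (pair_ix a b) (pair_rep a b g) T) x y w
    = pform a b n T (transpose g *v x) (transpose g *v y) w"
proof -
  have "mat_mul (pair_ix a b) (mtr (pcol a b x y)) (pair_rep a b g)
      = mtr (pcol a b (transpose g *v x) (transpose g *v y))"
    by (metis mtr_mat_mul mtr_mtr pair_rep_pcol pair_rep_transpose)
  then show ?thesis
    unfolding pform_def
    by (simp only: mat_mul_assoc flip: mat_mul_assoc[of _ _ "mtr (pcol a b x y)" "pair_rep a b g"])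
qed

lemma pform_spin_rep:
  "pform a b n (mat_mul {..n} T (spin_rep n g)) x y w = pform a b n T x y (g *v w)"
  unfolding pform_def by (simp only: mat_mul_assoc spin_rep_ccol)

lemma pform_sum_mat:
  "pform a b n (\<lambda>p l. \<Sum>t\<in>A. X t p l) x y w = (\<Sum>t\<in>A. pform a b n (X t) x y w)"
  unfolding pform_def by (simp add: mat_mul_sum_left mat_mul_sum_right)

text \<open>The single nonzero entry divides out the three roots contained in \<open>coh\<close>, so
  the generating function is one monomial with coefficient \<open>c\<close>. All entries are
  real.\<close>

definition monmat :: "nat \<Rightarrow> nat \<Rightarrow> nat \<Rightarrow> nat \<Rightarrow> nat \<Rightarrow> nat \<Rightarrow> real \<Rightarrow> (nat \<times> nat, nat) cmat" where
  "monmat a b n i j l c = (\<lambda>p k. if p = (i, j) \<and> k = l then complex_of_real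
     (c / (sqrt (real (a choose i)) * sqrt (real (b choose j)) * sqrt (real (n choose l)))) else 0)"

lemma msupp_monmat:
  "i \<le> a \<Longrightarrow> j \<le> b \<Longrightarrow> l \<le> n \<Longrightarrow> msupp (pair_ix a b) {..n} (monmat a b n i j l c)"
  by (auto simp: msupp_def monmat_def pair_ix_def spin_ix_def)

lemma pform_monmat:
  assumes "i \<le> a" "j \<le> b" "l \<le> n"
  shows "pform a b n (monmat a b n i j l c) x y w
    = of_real c * (x$1 ^ i * x$2 ^ (a - i)) * (y$1 ^ j * y$2 ^ (b - j)) * (w$1 ^ l * w$2 ^ (n - l))"
proof -
  define X where "X = coh a x i * coh b y j * monmat a b n i j l c (i, j) l * coh n w l"
  have "coh a x i' * coh b y j' * monmat a b n i j l c (i', j') l' * coh n w l'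
      = (if l' = l then (if j' = j then (if i' = i then X else 0) else 0) else 0)"
    for i' j' l' by (auto simp: monmat_def X_def)
  then have "pform a b n (monmat a b n i j l c) x y w = X"
    using assms by (simp add: pform_sum)
  also have "X = (complex_of_real (sqrt (real (a choose i))) * complex_of_real (sqrt (real (b choose j)))
      * complex_of_real (sqrt (real (n choose l))) * monmat a b n i j l c (i, j) l)
      * ((x$1 ^ i * x$2 ^ (a - i)) * (y$1 ^ j * y$2 ^ (b - j)) * (w$1 ^ l * w$2 ^ (n - l)))"
    using assms by (simp add: X_def coh_def)
  also have "complex_of_real (sqrt (real (a choose i))) * complex_of_real (sqrt (real (b choose j)))
      * complex_of_real (sqrt (real (n choose l))) * monmat a b n i j l c (i, j) l = of_real c"
    using assms by (simp add: monmat_def)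
  finally show ?thesis by (simp add: mult.assoc)
qed

text \<open>The generating function of the coupling \<open>V\<^sub>n \<rightarrow> V\<^sub>a \<otimes> V\<^sub>b\<close>, where \<open>n = a + b - 2 k\<close>.\<close>

definition cg_gen :: "nat \<Rightarrow> nat \<Rightarrow> nat \<Rightarrow> complex^2 \<Rightarrow> complex^2 \<Rightarrow> complex^2 \<Rightarrow> complex" where
  "cg_gen a b k x y w = cdot x w ^ (a - k) * cdot y w ^ (b - k) * wedge x y ^ k"

text \<open>Three binomial expansions are multiplied, with p, q and r counting the factors x_1 w_1,
  y_1 w_1 and x_1 y_2. Each summand is homogeneous of degree a in x, b in y and a + b - 2k in w,
  hence the generating function of a \<open>monmat\<close>.\<close>

lemma cg_gen_expand:
  assumes "k \<le> a" "k \<le> b"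
  shows "cg_gen a b k x y w = (\<Sum>p\<le>a - k. \<Sum>q\<le>b - k. \<Sum>r\<le>k.
     of_real (real (a - k choose p) * real (b - k choose q) * real (k choose r) * (-1) ^ (k - r))
     * (x$1 ^ (p + r) * x$2 ^ (a - (p + r))) * (y$1 ^ (q + (k - r)) * y$2 ^ (b - (q + (k - r))))
     * (w$1 ^ (p + q) * w$2 ^ (a + b - 2 * k - (p + q))))"
proof -
  have w: "wedge x y = x$1 * y$2 + (- 1) * (x$2 * y$1)"
    by (simp add: wedge_def)
  have "cg_gen a b k x y w = (\<Sum>p\<le>a - k. \<Sum>q\<le>b - k. \<Sum>r\<le>k.
     (of_nat (a - k choose p) * (x$1 * w$1) ^ p * (x$2 * w$2) ^ (a - k - p))
     * (of_nat (b - k choose q) * (y$1 * w$1) ^ q * (y$2 * w$2) ^ (b - k - q))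
     * (of_nat (k choose r) * (x$1 * y$2) ^ r * ((- 1) * (x$2 * y$1)) ^ (k - r)))"
    unfolding cg_gen_def cdot_def w binomial_ring
    by (subst sum_product) (simp only: sum_distrib_right, simp only: sum_distrib_left)
  also have "\<dots> = (\<Sum>p\<le>a - k. \<Sum>q\<le>b - k. \<Sum>r\<le>k.
     of_real (real (a - k choose p) * real (b - k choose q) * real (k choose r) * (-1) ^ (k - r))
     * (x$1 ^ (p + r) * x$2 ^ (a - (p + r))) * (y$1 ^ (q + (k - r)) * y$2 ^ (b - (q + (k - r))))
     * (w$1 ^ (p + q) * w$2 ^ (a + b - 2 * k - (p + q))))"
  proof (intro sum.cong refl)
    fix p q r assume "p \<in> {..a - k}" "q \<in> {..b - k}" "r \<in> {..k}"
    \<comment> \<open>Inside the summation ranges no natural subtraction truncates, so each exponent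
      splits into the contributions of the separate factors.\<close>
    then have "a - (p + r) = (a - k - p) + (k - r)" "b - (q + (k - r)) = (b - k - q) + r"
      "a + b - 2 * k - (p + q) = (a - k - p) + (b - k - q)"
      using assms by auto
    then show "(of_nat (a - k choose p) * (x$1 * w$1) ^ p * (x$2 * w$2) ^ (a - k - p))
     * (of_nat (b - k choose q) * (y$1 * w$1) ^ q * (y$2 * w$2) ^ (b - k - q))
     * (of_nat (k choose r) * (x$1 * y$2) ^ r * ((- 1) * (x$2 * y$1)) ^ (k - r)) =
     of_real (real (a - k choose p) * real (b - k choose q) * real (k choose r) * (-1) ^ (k - r))
     * (x$1 ^ (p + r) * x$2 ^ (a - (p + r))) * (y$1 ^ (q + (k - r)) * y$2 ^ (b - (q + (k - r))))
     * (w$1 ^ (p + q) * w$2 ^ (a + b - 2 * k - (p + q)))"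
      by (simp only: power_mult_distrib power_add) simp
  qed
  finally show ?thesis .
qed

lemma cg_exists:
  assumes "k \<le> a" "k \<le> b" and n: "n = a + b - 2 * k"
  obtains T where "msupp (pair_ix a b) {..n} T" "\<And>p l. T p l \<in> \<real>"
    "\<And>x y w. pform a b n T x y w = cg_gen a b k x y w"
proof (rule that)
  define c where "c p q r = real (a - k choose p) * real (b - k choose q) * real (k choose r) * (-1) ^ (k - r)"
    for p q r
  define T where "T = (\<lambda>u l. \<Sum>p\<le>a - k. \<Sum>q\<le>b - k. \<Sum>r\<le>k.
     monmat a b n (p + r) (q + (k - r)) (p + q) (c p q r) u l)"
  show "msupp (pair_ix a b) {..n} T"
    unfolding T_def using assms by (intro msupp_sum msupp_monmat) auto
  show "T u l \<in> \<real>" for u l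
    unfolding T_def monmat_def by (intro sum_in_Reals) auto
  show "pform a b n T x y w = cg_gen a b k x y w" for x y w
    unfolding cg_gen_expand[OF assms(1,2)] T_def pform_sum_mat n c_def
    by (intro sum.cong refl, subst pform_monmat) (use assms in auto)
qed

text \<open>These are the doubled spins |a - b|, |a - b| + 2, ..., a + b; the index k counts the
  \<open>wedge\<close> factors of the coupling.\<close>

definition cg_set :: "nat \<Rightarrow> nat \<Rightarrow> nat set" where
  "cg_set a b = (\<lambda>k. a + b - 2 * k) ` {..min a b}"

lemma finite_cg_set [simp]: "finite (cg_set a b)"
  by (simp add: cg_set_def)

text \<open>The coupling is equivariant because its generating function is built from
  \<open>cdot\<close> and \<open>wedge\<close>. Its transpose times itself is then an intertwiner of
  V_n, a scalar by Schur's lemma; for a real matrix this scalar is a sum of squares, and once it is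
  nonzero the coupling can be rescaled to an isometry.\<close>

lemma cg_isometry_exists:
  assumes "n \<in> cg_set a b"
  shows "\<exists>E. msupp (pair_ix a b) {..n} E \<and> (\<forall>p l. E p l \<in> \<real>) \<and>
    (\<forall>g\<in>SU2. mat_mul (pair_ix a b) (pair_rep a b g) E = mat_mul {..n} E (spin_rep n g)) \<and>
    mat_mul (pair_ix a b) (mtr E) E = mid {..n}"
proof -
  obtain k where k: "k \<le> a" "k \<le> b" and n: "n = a + b - 2 * k"
    using assms by (auto simp: cg_set_def)
  obtain T where supp: "msupp (pair_ix a b) {..n} T" and real: "\<And>p l. T p l \<in> \<real>"
    and form: "\<And>x y w. pform a b n T x y w = cg_gen a b k x y w"
    using cg_exists[OF k n] by metis
  have eqv: "mat_mul (pair_ix a b) (pair_rep a b g) T = mat_mul {..n} T (spin_rep n g)"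
    if g: "g \<in> SU2" for g
  proof (rule pform_eqI)
    fix x y w
    show "pform a b n (mat_mul (pair_ix a b) (pair_rep a b g) T) x y w
        = pform a b n (mat_mul {..n} T (spin_rep n g)) x y w"
      unfolding pform_pair_rep pform_spin_rep form cg_gen_def wedge_det
      by (simp add: SU2_det SU2_transpose g cdot_transpose del: transpose_matrix_vector)
  qed (use supp in \<open>auto intro: msupp_mat_mul\<close>)
  have eqv': "mat_mul {..n} (spin_rep n g) (mtr T) = mat_mul (pair_ix a b) (mtr T) (pair_rep a b g)"
    if g: "g \<in> SU2" for g
    using arg_cong[OF eqv[OF SU2_transpose[OF g]], of mtr]
    by (simp add: mtr_mat_mul pair_rep_transpose spin_rep_transpose)
  have "\<exists>c. mat_mul (pair_ix a b) (mtr T) T = (if n = n then mscale c (mid {..n}) else (\<lambda>i j. 0))"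
  proof (rule schur_equivariant)
    show "msupp {..n} {..n} (mat_mul (pair_ix a b) (mtr T) T)"
      using supp by (intro msupp_mat_mul[where C = "pair_ix a b"]) auto
    fix g assume g: "g \<in> SU2"
    have "mat_mul {..n} (mat_mul (pair_ix a b) (mtr T) T) (spin_rep n g)
        = mat_mul (pair_ix a b) (mat_mul (pair_ix a b) (mtr T) (pair_rep a b g)) T"
      by (simp only: mat_mul_assoc eqv[OF g])
    then show "mat_mul {..n} (mat_mul (pair_ix a b) (mtr T) T) (spin_rep n g)
        = mat_mul {..n} (spin_rep n g) (mat_mul (pair_ix a b) (mtr T) T)"
      by (simp only: eqv'[OF g, symmetric] mat_mul_assoc)
  qed
  then obtain c where c: "mat_mul (pair_ix a b) (mtr T) T = mscale c (mid {..n})" by auto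
  have Tr: "T p l * T p l = complex_of_real ((Re (T p l))\<^sup>2)" for p l
    using real[of p l] by (simp add: complex_is_Real_iff complex_eq_iff power2_eq_square)
  have cl: "c = complex_of_real (\<Sum>p\<in>pair_ix a b. (Re (T p l))\<^sup>2)" if "l \<le> n" for l
    using fun_cong[OF fun_cong[OF c, of l], of l] that
    by (simp add: mat_mul_def mtr_def mscale_def mid_def Tr)
  define d where "d = (\<Sum>p\<in>pair_ix a b. (Re (T p 0))\<^sup>2)"
  have cd: "c = of_real d" by (simp add: d_def cl[of 0])
  have "d \<noteq> 0"
  proof
    assume "d = 0"
    then have "(\<Sum>p\<in>pair_ix a b. (Re (T p l))\<^sup>2) = 0" if "l \<le> n" for l
      using cl[OF that] cd by (metis of_real_eq_iff)
    then have "Re (T p l) = 0" if "l \<le> n" "p \<in> pair_ix a b" for p l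
      using that by (simp add: sum_nonneg_eq_0_iff)
    then have "T p l = 0" for p l
      using supp real[of p l]
      by (cases p; cases "l \<le> n \<and> p \<in> pair_ix a b") (auto simp: msupp_def complex_is_Real_iff complex_eq_iff)
    \<comment> \<open>At these three points each of the factors \<open>cdot x w\<close>,
      \<open>cdot y w\<close> and \<open>wedge x y\<close> equals 1, so the generating function
      cannot vanish.\<close>
    then have "pform a b n T (vector [1, 0]) (vector [0, 1]) (vector [1, 1]) = 0"
      by (simp add: pform_sum)
    then show False
      by (simp add: form cg_gen_def cdot_def wedge_def)
  qed
  moreover have "d \<ge> 0" by (simp add: d_def sum_nonneg)
  ultimately have d: "d > 0" by simp
  define E where "E = mscale (of_real (1 / sqrt d)) T"
  have "mat_mul (pair_ix a b) (mtr E) E = mid {..n}"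
    using d by (simp add: E_def c cd flip: of_real_mult)
  then show ?thesis
    using supp eqv real by (intro exI[of _ E]) (auto simp: E_def msupp_mscale, simp add: mscale_def)
qed

section \<open>A fixed real isometric coupling for each spin, and orthogonality of their
  ranges\<close>

definition cgE :: "nat \<Rightarrow> nat \<Rightarrow> nat \<Rightarrow> (nat \<times> nat, nat) cmat" where
  "cgE a b n = (SOME E. msupp (pair_ix a b) {..n} E \<and> (\<forall>p l. E p l \<in> \<real>) \<and>
    (\<forall>g\<in>SU2. mat_mul (pair_ix a b) (pair_rep a b g) E = mat_mul {..n} E (spin_rep n g)) \<and>
    mat_mul (pair_ix a b) (mtr E) E = mid {..n})"

lemma
  assumes "n \<in> cg_set a b"
  shows msupp_cgE: "msupp (pair_ix a b) {..n} (cgE a b n)"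
    and cgE_real: "cgE a b n p l \<in> \<real>"
    and cgE_eqv: "g \<in> SU2 \<Longrightarrow>
      mat_mul (pair_ix a b) (pair_rep a b g) (cgE a b n) = mat_mul {..n} (cgE a b n) (spin_rep n g)"
    and cgE_isometry: "mat_mul (pair_ix a b) (mtr (cgE a b n)) (cgE a b n) = mid {..n}"
  using someI_ex[OF cg_isometry_exists[OF assms]] unfolding cgE_def by blast+

lemma cgE_eqv_mtr:
  assumes "n \<in> cg_set a b" "g \<in> SU2"
  shows "mat_mul {..n} (spin_rep n g) (mtr (cgE a b n))
    = mat_mul (pair_ix a b) (mtr (cgE a b n)) (pair_rep a b g)"
  using arg_cong[OF cgE_eqv[OF assms(1) SU2_transpose[OF assms(2)]], of mtr]
  by (simp add: mtr_mat_mul pair_rep_transpose spin_rep_transpose)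

text \<open>The component of \<open>T\<close> along V_n intertwines two different spins, so Schur's
  lemma applies. This yields the orthogonality of the couplings and later excludes all spins outside
  \<open>cg_set\<close>.\<close>

lemma cgE_component_equivariant:
  assumes n: "n \<in> cg_set a b" and supp: "msupp (pair_ix a b) {..m} T"
    and eqv: "\<And>g. g \<in> SU2 \<Longrightarrow> mat_mul (pair_ix a b) (pair_rep a b g) T = mat_mul {..m} T (spin_rep m g)"
    and ne: "n \<noteq> m"
  shows "mat_mul (pair_ix a b) (mtr (cgE a b n)) T = (\<lambda>i k. 0)"
proof -
  have "\<exists>c. mat_mul (pair_ix a b) (mtr (cgE a b n)) T = (if n = m then mscale c (mid {..m}) else (\<lambda>i j. 0))"
  proof (rule schur_equivariant)
    show "msupp {..n} {..m} (mat_mul (pair_ix a b) (mtr (cgE a b n)) T)"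
      using supp msupp_cgE[OF n] by (intro msupp_mat_mul[where C = "pair_ix a b"]) auto
    fix g assume g: "g \<in> SU2"
    have "mat_mul {..m} (mat_mul (pair_ix a b) (mtr (cgE a b n)) T) (spin_rep m g)
        = mat_mul (pair_ix a b) (mat_mul (pair_ix a b) (mtr (cgE a b n)) (pair_rep a b g)) T"
      by (simp only: mat_mul_assoc eqv[OF g])
    then show "mat_mul {..m} (mat_mul (pair_ix a b) (mtr (cgE a b n)) T) (spin_rep m g)
        = mat_mul {..n} (spin_rep n g) (mat_mul (pair_ix a b) (mtr (cgE a b n)) T)"
      by (simp only: cgE_eqv_mtr[OF n g, symmetric] mat_mul_assoc)
  qed
  then show ?thesis using ne by auto
qed

lemma cgE_orth:
  assumes "n \<in> cg_set a b" "m \<in> cg_set a b"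
  shows "mat_mul (pair_ix a b) (mtr (cgE a b n)) (cgE a b m)
    = (if n = m then mid {..n} else (\<lambda>i k. 0))"
  using cgE_isometry[OF assms(1)] cgE_component_equivariant[OF assms(1) msupp_cgE[OF assms(2)]]
    cgE_eqv[OF assms(2)] by auto

lemma inj_on_cg: "inj_on (\<lambda>k. a + b - 2 * k) {..min a b}" for a b :: nat
  by (auto simp: inj_on_def)

text \<open>This is the dimension count for V_a and V_b. The upper limit is generalised to m for the
  induction; at the minimum of a and b the two factors of the closed form are one plus the minimum
  and one plus the maximum.\<close>

lemma sum_cg_set: "(\<Sum>n\<in>cg_set a b. real n + 1) = real ((a + 1) * (b + 1))"
proof -
  have "(\<Sum>k\<le>m. real (a + b - 2 * k) + 1) = (real m + 1) * (real a + real b + 1 - real m)"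
    if "m \<le> min a b" for m
    using that by (induction m) (auto simp: algebra_simps of_nat_diff)
  from this[of "min a b"] have "(\<Sum>n\<in>cg_set a b. real n + 1)
      = (real (min a b) + 1) * (real a + real b + 1 - real (min a b))"
    by (simp add: cg_set_def sum.reindex[OF inj_on_cg])
  then show ?thesis
    by (cases "a \<le> b") (simp_all add: min_def algebra_simps)
qed

text \<open>For \<open>n\<close> in \<open>cg_set a b\<close> this is the orthogonal projection onto
  the copy of V_n, the coupling being a real isometry.\<close>

definition cgP :: "nat \<Rightarrow> nat \<Rightarrow> nat \<Rightarrow> (nat \<times> nat, nat \<times> nat) cmat" where
  "cgP a b n = mat_mul {..n} (cgE a b n) (mtr (cgE a b n))"

lemma cgP_orth:
  assumes "n \<in> cg_set a b" "m \<in> cg_set a b"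
  shows "mat_mul (pair_ix a b) (cgP a b n) (cgP a b m) = (if n = m then cgP a b n else (\<lambda>p q. 0))"
proof -
  have "mat_mul (pair_ix a b) (cgP a b n) (cgP a b m) = mat_mul {..n} (cgE a b n)
      (mat_mul {..m} (mat_mul (pair_ix a b) (mtr (cgE a b n)) (cgE a b m)) (mtr (cgE a b m)))"
    by (simp only: cgP_def mat_mul_assoc)
  then show ?thesis
    using mat_mul_mid_left[of "{..m}" "pair_ix a b" "mtr (cgE a b m)"] msupp_cgE[OF assms(2)]
    by (auto simp: cgE_orth[OF assms] cgP_def)
qed

lemma cgP_trace:
  assumes "n \<in> cg_set a b"
  shows "(\<Sum>p\<in>pair_ix a b. cgP a b n p p) = of_real (real n + 1)"
proof -
  have "(\<Sum>p\<in>pair_ix a b. cgP a b n p p)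
      = (\<Sum>k\<le>n. mat_mul (pair_ix a b) (mtr (cgE a b n)) (cgE a b n) k k)"
    unfolding cgP_def mat_mul_def mtr_def by (subst sum.swap) simp
  also have "\<dots> = of_real (real n + 1)"
    by (simp add: cgE_isometry[OF assms] mid_def)
  finally show ?thesis .
qed

lemma msupp_cgP:
  assumes "n \<in> cg_set a b"
  shows "msupp (pair_ix a b) (pair_ix a b) (cgP a b n)"
  using msupp_cgE[OF assms] unfolding cgP_def by (intro msupp_mat_mul) auto

text \<open>The complement of the range of all the \<open>V\<^sub>n\<close> is the image of an orthogonal projection; by the
  dimension count its trace, which is its squared Hilbert--Schmidt norm, vanishes.\<close>

lemma cgE_complete:
  "(\<lambda>p q. \<Sum>n\<in>cg_set a b. cgP a b n p q) = mid (pair_ix a b)"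
proof -
  define B where "B = pair_ix a b"
  define P where "P = cgP a b"
  define S where "S = (\<lambda>p q. \<Sum>n\<in>cg_set a b. P n p q)"
  define Q where "Q = (\<lambda>p q. mid B p q - S p q)"
  have Ssupp: "msupp B B S"
    unfolding S_def P_def B_def by (intro msupp_sum msupp_cgP)
  have SS: "mat_mul B S S = S"
    unfolding S_def mat_mul_sum_left mat_mul_sum_right
    by (intro ext sum.cong refl) (simp add: P_def B_def cgP_orth if_distrib if_distribR cong: if_cong)
  have fin: "finite B" by (simp add: B_def)
  have Q0: "mat_mul B Q Q = Q"
  proof (intro ext)
    fix p q
    have "mat_mul B Q Q p q = mat_mul B (mid B) (mid B) p q - mat_mul B (mid B) S p q
        - mat_mul B S (mid B) p q + mat_mul B S S p q"
      by (simp add: Q_def mat_mul_def algebra_simps sum.distrib sum_subtractf)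
    moreover have "mat_mul B (mid B) (mid B) = mid B"
      by (rule mat_mul_mid_left[where C = B]) (auto simp: fin msupp_def mid_def)
    ultimately show "mat_mul B Q Q p q = Q p q"
      using Ssupp by (simp add: SS Q_def mat_mul_mid_left[OF fin Ssupp] mat_mul_mid_right[OF fin Ssupp])
  qed
  have Psym: "P n q p = P n p q" for n p q
    by (simp add: P_def cgP_def mat_mul_def mtr_def mult.commute)
  have Qsym: "Q q p = Q p q" for p q
    by (auto simp: Q_def S_def Psym mid_def)
  have Preal: "P n p q \<in> \<real>" if "n \<in> cg_set a b" for n p q
    unfolding P_def cgP_def mat_mul_def mtr_def using cgE_real[OF that] by (intro sum_in_Reals Reals_mult) auto
  have Qreal: "Q p q \<in> \<real>" for p q
    unfolding Q_def S_def by (intro Reals_diff sum_in_Reals Preal) (auto simp: mid_def)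
  have "(\<Sum>p\<in>B. S p p) = (\<Sum>n\<in>cg_set a b. of_real (real n + 1))"
    unfolding S_def by (subst sum.swap) (simp add: P_def B_def cgP_trace)
  also have "\<dots> = of_nat (card B)"
    using arg_cong[OF sum_cg_set[of a b], of complex_of_real]
    by (simp add: B_def pair_ix_def spin_ix_def algebra_simps)
  finally have "(\<Sum>p\<in>B. Q p p) = 0"
    by (simp add: Q_def sum_subtractf mid_def)
  also have "(\<Sum>p\<in>B. Q p p) = (\<Sum>p\<in>B. \<Sum>q\<in>B. Q p q * Q p q)"
    by (subst Q0[symmetric]) (simp add: mat_mul_def Qsym)
  also have "\<dots> = of_real (\<Sum>p\<in>B. \<Sum>q\<in>B. (Re (Q p q))\<^sup>2)"
    unfolding of_real_sum
    by (intro sum.cong refl) (use Qreal in \<open>simp add: complex_is_Real_iff complex_eq_iff power2_eq_square\<close>)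
  finally have "(\<Sum>p\<in>B. \<Sum>q\<in>B. (Re (Q p q))\<^sup>2) = 0"
    by (simp only: of_real_eq_0_iff)
  then have "Re (Q p q) = 0" if "p \<in> B" "q \<in> B" for p q
    using that by (simp add: sum_nonneg_eq_0_iff sum_nonneg fin)
  then have "Q p q = 0" if "p \<in> B" "q \<in> B" for p q
    using that Qreal by (simp add: complex_is_Real_iff complex_eq_iff)
  moreover have "Q p q = 0" if "\<not> (p \<in> B \<and> q \<in> B)" for p q
  proof -
    have "S p q = 0" using Ssupp that unfolding msupp_def by blast
    moreover have "mid B p q = 0" using that by (auto simp: mid_def)
    ultimately show ?thesis by (simp add: Q_def)
  qed
  ultimately have "S = mid B"
    by (metis (no_types) Q_def eq_iff_diff_eq_0 ext)
  then show ?thesis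
    by (simp add: S_def P_def B_def)
qed

section \<open>From matrices to vectors: which spins occur in a product of two\<close>

lemma mat_app_mat_mul: "mat_app C (mat_mul B X Y) v = mat_app B X (mat_app C Y v)"
proof
  fix i
  have "mat_app C (mat_mul B X Y) v i = (\<Sum>c\<in>C. \<Sum>b\<in>B. X i b * (Y b c * v c))"
    by (simp add: mat_app_def mat_mul_def sum_distrib_right mult.assoc)
  also have "\<dots> = mat_app B X (mat_app C Y v) i"
    by (subst sum.swap) (simp add: mat_app_def sum_distrib_left)
  finally show "mat_app C (mat_mul B X Y) v i = mat_app B X (mat_app C Y v) i" .
qed

definition cunit :: "'i \<Rightarrow> 'i cvec" where
  "cunit k = (\<lambda>i. if i = k then 1 else 0)"

lemma mat_app_cunit: "finite B \<Longrightarrow> k \<in> B \<Longrightarrow> mat_app B A (cunit k) = (\<lambda>i. A i k)"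
  by (simp add: mat_app_def cunit_def if_distrib cong: if_cong)

lemma cunit_in_cspace: "k \<in> B \<Longrightarrow> cunit k \<in> cspace B"
  by (auto simp: cunit_def cspace_def)

lemma mat_app_cspace: "msupp B C A \<Longrightarrow> mat_app C A v \<in> cspace B"
  by (auto simp: msupp_def mat_app_def cspace_def)

lemma mat_app_mid: "finite B \<Longrightarrow> v \<in> cspace B \<Longrightarrow> mat_app B (mid B) v = v"
proof
  fix i assume "finite B" "v \<in> cspace B"
  moreover have "mat_app B (mid B) v i = (\<Sum>k\<in>B. if i = k then v k else 0)"
    unfolding mat_app_def mid_def by (rule sum.cong) auto
  ultimately show "mat_app B (mid B) v i = v i" by (auto simp: cspace_def)
qed

text \<open>The couplings give the embeddings. Conversely, an embedding of a spin outside
  \<open>cg_set\<close> has zero component along every V_m; as the projections sum to the identity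
  it is zero, against injectivity.\<close>

lemma occurs_in_pair_iff: "occurs_in n (pair_ix a b) (pair_rep a b) \<longleftrightarrow> n \<in> cg_set a b"
proof
  assume n: "n \<in> cg_set a b"
  let ?E = "cgE a b n"
  have "inj_on (mat_app (spin_ix n) ?E) (cspace (spin_ix n))"
  proof (rule inj_on_inverseI)
    fix v :: "nat \<Rightarrow> complex" assume "v \<in> cspace (spin_ix n)"
    then show "mat_app (pair_ix a b) (mtr ?E) (mat_app (spin_ix n) ?E v) = v"
      by (simp add: spin_ix_def cgE_isometry[OF n] mat_app_mid flip: mat_app_mat_mul)
  qed
  then show "occurs_in n (pair_ix a b) (pair_rep a b)"
    unfolding occurs_in_def
    by (intro exI[of _ ?E])
      (auto simp: spin_ix_def mat_app_cspace[OF msupp_cgE[OF n]] cgE_eqv[OF n] simp flip: mat_app_mat_mul)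
next
  assume "occurs_in n (pair_ix a b) (pair_rep a b)"
  then obtain T :: "(nat \<times> nat, nat) cmat" where
    T: "mat_app {..n} T ` cspace {..n} \<subseteq> cspace (pair_ix a b)"
    and inj: "inj_on (mat_app {..n} T) (cspace {..n})"
    and eqv: "\<And>g v. g \<in> SU2 \<Longrightarrow> v \<in> cspace {..n} \<Longrightarrow>
        mat_app {..n} T (mat_app {..n} (spin_rep n g) v) = mat_app (pair_ix a b) (pair_rep a b g) (mat_app {..n} T v)"
    unfolding occurs_in_def spin_ix_def by blast
  \<comment> \<open>The columns of \<open>T\<close> beyond n are unconstrained by
    \<open>occurs_in\<close>; cutting them off provides the support condition without changing the
    operator.\<close>
  define U where "U = (\<lambda>p k. if k \<le> n then T p k else 0)"
  have U: "mat_app {..n} U v = mat_app {..n} T v" for v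
    by (simp add: mat_app_def U_def)
  have Ucol: "(\<lambda>p. U p k) = mat_app {..n} U (cunit k)" if "k \<le> n" for k
    using that by (simp add: mat_app_cunit)
  have "(\<lambda>p. U p k) \<in> cspace (pair_ix a b)" if "k \<le> n" for k
    using T cunit_in_cspace[of k "{..n}"] that unfolding Ucol[OF that] U by auto
  then have supp: "msupp (pair_ix a b) {..n} U"
    unfolding msupp_def cspace_def by (auto simp: U_def)
  have eqv': "mat_mul (pair_ix a b) (pair_rep a b g) U = mat_mul {..n} U (spin_rep n g)"
    if g: "g \<in> SU2" for g
  proof (intro ext)
    fix p :: "nat \<times> nat" and k
    show "mat_mul (pair_ix a b) (pair_rep a b g) U p k = mat_mul {..n} U (spin_rep n g) p k"
    proof (cases "k \<le> n")
      case True
      then have "mat_app {..n} (mat_mul {..n} U (spin_rep n g)) (cunit k)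
          = mat_app {..n} (mat_mul (pair_ix a b) (pair_rep a b g) U) (cunit k)"
        using eqv[OF g cunit_in_cspace[of k "{..n}"]] by (simp add: mat_app_mat_mul U)
      then show ?thesis using True by (simp add: mat_app_cunit) metis
    next
      case False
      then show ?thesis by (simp add: mat_mul_def U_def spin_rep_def)
    qed
  qed
  show "n \<in> cg_set a b"
  proof (rule ccontr)
    assume "n \<notin> cg_set a b"
    then have zero: "mat_mul (pair_ix a b) (mtr (cgE a b m)) U = (\<lambda>i k. 0)" if "m \<in> cg_set a b" for m
      using cgE_component_equivariant[OF that supp eqv'] that by blast
    have "U = mat_mul (pair_ix a b) (mid (pair_ix a b)) U"
      using supp by (simp add: mat_mul_mid_left)
    also have "\<dots> = (\<lambda>i k. 0)"
      unfolding cgE_complete[symmetric] mat_mul_sum_left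
      by (simp add: cgP_def mat_mul_assoc zero)
    finally have "mat_app {..n} T (cunit 0) = mat_app {..n} T (\<lambda>i. 0)"
      by (subst (1 2) U[symmetric]) (simp add: mat_app_def)
    then have "cunit 0 = (\<lambda>i::nat. 0 :: complex)"
      by (rule inj_onD[OF inj]) (auto simp: cspace_def cunit_def)
    then have "cunit 0 (0::nat) = (0 :: complex)" by (rule fun_cong)
    then show False by (simp add: cunit_def)
  qed
qed

lemma intermediate_spins_eq: "intermediate_spins a b c d = cg_set a b \<inter> cg_set c d"
  by (auto simp: intermediate_spins_def occurs_in_pair_iff)

section \<open>Fourth moments of a Haar-random vector\<close>

lemma cinner_cnj: "cnj (cinner B v w) = cinner B w v"
  by (simp add: cinner_def mult.commute)

lemma cinner_diff_right: "cinner B v (\<lambda>i. x i - y i) = cinner B v x - cinner B v y"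
  by (simp add: cinner_def algebra_simps sum_subtractf)

lemma cinner_diff_left: "cinner B (\<lambda>i. x i - y i) v = cinner B x v - cinner B y v"
  by (simp add: cinner_def algebra_simps sum_subtractf)

lemma cinner_add_left: "cinner B (\<lambda>i. x i + y i) v = cinner B x v + cinner B y v"
  by (simp add: cinner_def algebra_simps sum.distrib)

lemma cinner_add_right: "cinner B v (\<lambda>i. x i + y i) = cinner B v x + cinner B v y"
  by (simp add: cinner_def algebra_simps sum.distrib)

lemma cinner_scale_right: "cinner B v (\<lambda>i. c * x i) = c * cinner B v x"
  by (simp add: cinner_def sum_distrib_left mult_ac)

lemma cinner_scale_left: "cinner B (\<lambda>i. c * x i) v = cnj c * cinner B x v"
  by (simp add: cinner_def sum_distrib_left mult_ac)

lemma cinner_sum_right: "cinner B v (\<lambda>i. \<Sum>n\<in>S. c n * x n i) = (\<Sum>n\<in>S. c n * cinner B v (x n))"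
  unfolding cinner_def sum_distrib_left by (subst sum.swap) (simp add: mult_ac)

lemma cinner_self: "cinner B v v = of_real (\<Sum>i\<in>B. (cmod (v i))\<^sup>2)"
  by (simp add: cinner_def complex_norm_square mult.commute del: of_real_power)

lemma mat_app_zero [simp]: "mat_app B A (\<lambda>i. 0) = (\<lambda>i. 0)"
  by (simp add: mat_app_def)

lemma unitary_group_mat_mul:
  assumes V: "V \<in> unitary_group B H" and U: "U \<in> unitary_group B H"
  shows "mat_mul B V U \<in> unitary_group B H"
proof -
  have "mat_app B (mat_mul B V U) ` H = mat_app B V ` mat_app B U ` H"
    by (simp add: mat_app_mat_mul image_image)
  moreover have "cinner B (mat_app B (mat_mul B V U) v) (mat_app B (mat_mul B V U) w) = cinner B v w"
    if "v \<in> H" "w \<in> H" for v w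
  proof -
    have "mat_app B U v \<in> H" "mat_app B U w \<in> H"
      using U that by (auto simp: unitary_group_def)
    then show ?thesis
      using U V that by (simp add: mat_app_mat_mul unitary_group_def)
  qed
  moreover have "mat_mul B V U i k = 0" if "i \<notin> B \<or> k \<notin> B" for i k
    using assms that by (auto simp: mat_mul_def unitary_group_def)
  moreover have "mat_app B (mat_mul B V U) v = 0" if "v \<in> cspace B" "\<forall>w\<in>H. cinner B w v = 0" for v
  proof -
    have "mat_app B U v = (\<lambda>i. 0)"
      using U that by (simp add: unitary_group_def zero_fun_def)
    then show ?thesis by (simp only: mat_app_mat_mul) (simp add: zero_fun_def)
  qed
  ultimately show ?thesis
    using U V unfolding unitary_group_def by simp
qed

lemma borel_measurable_haar:
  assumes "haar_measure B H \<mu>" and "continuous_on UNIV f"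
  shows "f \<in> borel_measurable \<mu>"
proof -
  have "f \<in> borel_measurable (restrict_space borel (unitary_group B H))"
    using assms(2) by (intro measurable_restrict_space1 borel_measurable_continuous_onI)
  moreover have "sets \<mu> = sets (restrict_space borel (unitary_group B H))"
    using assms(1) by (simp add: haar_measure_def)
  ultimately show ?thesis
    using measurable_cong_sets by blast
qed

lemma continuous_on_entry: "continuous_on UNIV (\<lambda>U :: 'i \<Rightarrow> 'k \<Rightarrow> complex. U i k)"
  by (rule continuous_on_compose2[OF continuous_on_product_coordinates[of k]
        continuous_on_product_coordinates[of i]]) auto

lemma mat_mul_measurable_haar:
  assumes haar: "haar_measure B H \<mu>" and V: "V \<in> unitary_group B H"
  shows "(\<lambda>U. mat_mul B V U) \<in> measurable \<mu> \<mu>"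
proof -
  have sets: "sets \<mu> = sets (restrict_space borel (unitary_group B H))"
    and space: "space \<mu> = unitary_group B H"
    using haar by (auto simp: haar_measure_def)
  have "continuous_on UNIV (\<lambda>U. mat_mul B V U)"
    unfolding mat_mul_def
    by (intro continuous_on_coordinatewise_then_product continuous_intros continuous_on_entry)
  then have "(\<lambda>U. mat_mul B V U) \<in> borel_measurable \<mu>"
    by (rule borel_measurable_haar[OF haar])
  then have "(\<lambda>U. mat_mul B V U) \<in> measurable \<mu> (restrict_space borel (unitary_group B H))"
    by (intro measurable_restrict_space2) (auto simp: space unitary_group_mat_mul[OF V])
  then show ?thesis
    using measurable_cong_sets[OF refl sets] by blast
qed

text \<open>Averaging over a phase removes the interference terms.\<close>

lemma cmod_phase_average:
  "cmod (x + y) ^ 4 + cmod (x + \<i> * y) ^ 4 + cmod (x - y) ^ 4 + cmod (x - \<i> * y) ^ 4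
    = 4 * (cmod x ^ 4 + cmod y ^ 4 + 4 * ((cmod x)\<^sup>2 * (cmod y)\<^sup>2))"
proof -
  have 4: "cmod z ^ 4 = ((Re z)\<^sup>2 + (Im z)\<^sup>2)\<^sup>2" for z
    by (simp flip: cmod_power2)
  show ?thesis
    unfolding 4 cmod_power2 by (simp add: power2_eq_square) algebra
qed

text \<open>The assumptions \<open>comb_in_H\<close> and \<open>expand\<close> together say that
  \<open>H\<close> is exactly the span of the orthonormal family. The moment computation needs only
  this, and is thereby separated from the representation theory.\<close>

locale onb =
  fixes B :: "'i set" and H :: "'i cvec set" and S :: "'s set" and e :: "'s \<Rightarrow> 'i cvec"
  assumes finite_B: "finite B" and finite_S: "finite S"
    and comb_in_H: "(\<lambda>i. \<Sum>n\<in>S. c n * e n i) \<in> H"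
    and e_in_cspace: "n \<in> S \<Longrightarrow> e n \<in> cspace B"
    and orth: "n \<in> S \<Longrightarrow> m \<in> S \<Longrightarrow> cinner B (e n) (e m) = (if n = m then 1 else 0)"
    and expand: "v \<in> H \<Longrightarrow> v = (\<lambda>i. \<Sum>n\<in>S. cinner B (e n) v * e n i)"
begin

lemma H_cspace: "v \<in> H \<Longrightarrow> v \<in> cspace B"
  by (subst expand) (use e_in_cspace in \<open>auto simp: cspace_def\<close>)

lemma cinner_e_comb:
  assumes "n \<in> S"
  shows "cinner B (e n) (\<lambda>i. \<Sum>m\<in>S. c m * e m i) = c n"
proof -
  have "cinner B (e n) (\<lambda>i. \<Sum>m\<in>S. c m * e m i) = (\<Sum>m\<in>S. if n = m then c m else 0)"
    unfolding cinner_sum_right by (rule sum.cong) (auto simp: orth assms)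
  then show ?thesis using assms finite_S by simp
qed

lemma H_lincomb:
  assumes "v \<in> H" "w \<in> H"
  shows "(\<lambda>i. a * v i + b * w i) \<in> H"
proof -
  have "(\<lambda>i. a * v i + b * w i)
      = (\<lambda>i. \<Sum>n\<in>S. (a * cinner B (e n) v + b * cinner B (e n) w) * e n i)"
    by (subst expand[OF assms(1)], subst expand[OF assms(2)])
      (simp add: algebra_simps sum.distrib sum_distrib_left)
  then show ?thesis by (simp add: comb_in_H)
qed

lemma e_in_H: "n \<in> S \<Longrightarrow> e n \<in> H"
proof -
  assume n: "n \<in> S"
  have "(\<lambda>i. \<Sum>m\<in>S. (if m = n then 1 else 0) * e m i) = e n"
  proof
    fix i
    have "(\<Sum>m\<in>S. (if m = n then 1 else 0) * e m i) = (\<Sum>m\<in>S. if m = n then e n i else 0)"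
      by (rule sum.cong) auto
    then show "(\<Sum>m\<in>S. (if m = n then 1 else 0) * e m i) = e n i"
      using n finite_S by simp
  qed
  then show ?thesis using comb_in_H[of "\<lambda>m. if m = n then 1 else 0"] by simp
qed

lemma parseval:
  assumes "w \<in> H"
  shows "cinner B v w = (\<Sum>n\<in>S. cinner B v (e n) * cinner B (e n) w)"
  by (subst expand[OF assms]) (subst cinner_sum_right, simp add: mult.commute)

text \<open>The first sum is the projection onto \<open>H\<close>, so the operator vanishes on the
  orthogonal complement as \<open>unitary_group\<close> demands. For u in \<open>H\<close> and c = 2
  / <u, u> it is the Householder reflection of \<open>H\<close> along u.\<close>

definition reflection :: "complex \<Rightarrow> 'i cvec \<Rightarrow> ('i, 'i) cmat" where
  "reflection c u = (\<lambda>i k. (\<Sum>n\<in>S. e n i * cnj (e n k)) - c * (u i * cnj (u k)))"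

lemma mat_app_reflection:
  "mat_app B (reflection c u) v = (\<lambda>i. (\<Sum>n\<in>S. cinner B (e n) v * e n i) - c * cinner B u v * u i)"
proof
  fix i
  have "mat_app B (reflection c u) v i
      = (\<Sum>k\<in>B. \<Sum>n\<in>S. e n i * (cnj (e n k) * v k)) - (\<Sum>k\<in>B. c * u i * (cnj (u k) * v k))"
    by (simp add: mat_app_def reflection_def algebra_simps sum_subtractf sum_distrib_left)
  also have "(\<Sum>k\<in>B. \<Sum>n\<in>S. e n i * (cnj (e n k) * v k)) = (\<Sum>n\<in>S. cinner B (e n) v * e n i)"
    by (subst sum.swap) (simp add: cinner_def mult.commute flip: sum_distrib_left)
  also have "(\<Sum>k\<in>B. c * u i * (cnj (u k) * v k)) = c * cinner B u v * u i"
    by (simp add: cinner_def mult_ac flip: sum_distrib_left)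
  finally show "mat_app B (reflection c u) v i = (\<Sum>n\<in>S. cinner B (e n) v * e n i) - c * cinner B u v * u i" .
qed

lemma mat_app_reflection_H:
  "v \<in> H \<Longrightarrow> mat_app B (reflection c u) v = (\<lambda>i. v i - c * cinner B u v * u i)"
  unfolding mat_app_reflection by (metis (no_types) expand)

text \<open>The condition on c makes the map an involution of \<open>H\<close>, hence onto, and with
  c real it makes the correction terms in the inner product cancel.\<close>

lemma reflection_unitary:
  assumes u: "u \<in> H" and c: "c * cinner B u u = 2" "cnj c = c"
  shows "reflection c u \<in> unitary_group B H"
proof -
  have in_H: "mat_app B (reflection c u) v \<in> H" if "v \<in> H" for v
    using H_lincomb[OF that u, of 1 "- (c * cinner B u v)"] by (simp add: mat_app_reflection_H that)
  have invol: "mat_app B (reflection c u) (mat_app B (reflection c u) v) = v" if v: "v \<in> H" for v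
  proof -
    have "c * (cinner B u v - c * cinner B u v * cinner B u u) = - (c * cinner B u v)"
      using c(1) by (simp add: algebra_simps)
    then show ?thesis
      by (simp add: mat_app_reflection_H[OF in_H[OF v]])
        (simp add: mat_app_reflection_H[OF v] cinner_diff_right cinner_scale_right)
  qed
  have image: "mat_app B (reflection c u) ` H = H"
    using in_H invol by (auto simp: image_def) (metis)
  have inner: "cinner B (mat_app B (reflection c u) v) (mat_app B (reflection c u) w) = cinner B v w"
    if "v \<in> H" "w \<in> H" for v w
  proof -
    have "cinner B (mat_app B (reflection c u) v) (mat_app B (reflection c u) w)
        = cinner B v w - c * cinner B u w * cinner B v u - c * cinner B v u * cinner B u w
          + c * cinner B u w * cinner B v u * (c * cinner B u u)"
      unfolding mat_app_reflection_H[OF that(1)] mat_app_reflection_H[OF that(2)] cinner_diff_right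
        cinner_diff_left cinner_scale_right cinner_scale_left
      by (simp add: c(2) cinner_cnj algebra_simps)
    then show ?thesis unfolding c(1) by simp
  qed
  have "reflection c u i k = 0" if "i \<notin> B \<or> k \<notin> B" for i k
    using that e_in_cspace H_cspace[OF u] by (auto simp: reflection_def cspace_def)
  moreover have "mat_app B (reflection c u) v = 0" if "\<forall>w\<in>H. cinner B w v = 0" for v
    using that u e_in_H by (simp add: mat_app_reflection fun_eq_iff)
  ultimately show ?thesis
    using image inner by (simp add: unitary_group_def)
qed

text \<open>The reflection along \<open>v - w\<close> maps \<open>v\<close> to \<open>w\<close> exactly because their inner product is real.\<close>

lemma fourth_moment_unit_vectors:
  assumes haar: "haar_measure B H \<mu>" and v0: "v0 \<in> H"
    and v: "v \<in> H" "cinner B v v = 1" and w: "w \<in> H" "cinner B w w = 1"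
    and real: "cinner B v w \<in> \<real>"
  shows "(\<integral>U. cmod (cinner B w (mat_app B U v0)) ^ 4 \<partial>\<mu>)
    = (\<integral>U. cmod (cinner B v (mat_app B U v0)) ^ 4 \<partial>\<mu>)"
proof (cases "v = w")
  case False
  define u where "u = (\<lambda>i. v i - w i)"
  have u: "u \<in> H"
    using H_lincomb[OF v(1) w(1), of 1 "-1"] by (simp add: u_def)
  define r where "r = cinner B v w"
  have r: "cinner B w v = r"
    using real cinner_cnj[of B v w] by (simp add: r_def Reals_cnj_iff)
  have uu: "cinner B u u = 2 * (1 - r)" and uv: "cinner B u v = 1 - r"
    by (simp_all add: u_def cinner_diff_left cinner_diff_right v w r r_def[symmetric])
  \<comment> \<open>Since <u, u> = 2 (1 - r), the value r = 1 would force v = w.\<close>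
  have "r \<noteq> 1"
  proof
    assume "r = 1"
    then have "(\<Sum>i\<in>B. (cmod (u i))\<^sup>2) = 0"
      using uu cinner_self[of B u] by (simp flip: of_real_sum of_real_power)
    then have "u i = 0" if "i \<in> B" for i
      using that finite_B by (simp add: sum_nonneg_eq_0_iff)
    then have "v = w"
      using H_cspace[OF v(1)] H_cspace[OF w(1)] by (auto simp: u_def cspace_def fun_eq_iff) metis
    then show False using False by simp
  qed
  \<comment> \<open>This is 2 / <u, u>, the Householder constant.\<close>
  define c where "c = 1 / (1 - r)"
  have "cnj r = r" using real by (simp add: r_def Reals_cnj_iff)
  then have V: "reflection c u \<in> unitary_group B H"
    using \<open>r \<noteq> 1\<close> by (intro reflection_unitary u) (simp_all add: c_def uu field_simps)
  have Vv: "mat_app B (reflection c u) v = w"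
    using \<open>r \<noteq> 1\<close> by (simp add: mat_app_reflection_H v uv c_def) (simp add: u_def)
  \<comment> \<open>Left invariance replaces U by V U for the reflection V. As V v = w and V is
    unitary, <w, V U v0> = <v, U v0>.\<close>
  let ?f = "\<lambda>U. cmod (cinner B w (mat_app B U v0)) ^ 4"
  have meas: "?f \<in> borel_measurable \<mu>"
    unfolding cinner_def mat_app_def
    by (intro borel_measurable_haar[OF haar] continuous_intros continuous_on_entry)
  have "(\<integral>U. ?f U \<partial>\<mu>) = (\<integral>U. ?f U \<partial>distr \<mu> \<mu> (\<lambda>U. mat_mul B (reflection c u) U))"
    using haar V by (simp add: haar_measure_def)
  also have "\<dots> = (\<integral>U. ?f (mat_mul B (reflection c u) U) \<partial>\<mu>)"
    by (rule integral_distr[OF mat_mul_measurable_haar[OF haar V] meas])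
  also have "\<dots> = (\<integral>U. cmod (cinner B v (mat_app B U v0)) ^ 4 \<partial>\<mu>)"
  proof (rule Bochner_Integration.integral_cong[OF refl])
    fix U assume "U \<in> space \<mu>"
    then have "mat_app B U v0 \<in> H"
      using haar v0 by (auto simp: haar_measure_def unitary_group_def)
    then show "?f (mat_mul B (reflection c u) U) = cmod (cinner B v (mat_app B U v0)) ^ 4"
      using V v(1) by (subst Vv[symmetric]) (simp add: mat_app_mat_mul unitary_group_def)
  qed
  finally show ?thesis .
qed simp

text \<open>Let G be the common fourth moment of the coordinates. Comparing \<open>e n\<close> with
  the unit vectors (e_n + cnj a e_m) / sqrt 2 shows that each mixed moment of |x_n|^2 |x_m|^2 is G /
  2. With D = \<open>card S\<close>, integrating the square of the normalisation gives G (D + D (D -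
  1) / 2) = 1.\<close>

lemma fourth_moment:
  assumes haar: "haar_measure B H \<mu>" and v0: "unit_vector B H v0" and n: "n \<in> S"
  shows "(\<integral>U. cmod (cinner B (e n) (mat_app B U v0)) ^ 4 \<partial>\<mu>)
    = 2 / ((real (card S))\<^sup>2 + real (card S))"
proof -
  interpret prob_space \<mu> using haar by (simp add: haar_measure_def)
  have v0H: "v0 \<in> H" and v01: "cinner B v0 v0 = 1"
    using v0 by (auto simp: unit_vector_def)
  define x where "x n U = cinner B (e n) (mat_app B U v0)" for n U
  have sum1: "(\<Sum>n\<in>S. (cmod (x n U))\<^sup>2) = 1" if "U \<in> space \<mu>" for U
  proof -
    have U: "U \<in> unitary_group B H" using haar that by (simp add: haar_measure_def)
    then have "mat_app B U v0 \<in> H" using v0H by (auto simp: unitary_group_def)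
    then have "cinner B (mat_app B U v0) (mat_app B U v0) = of_real (\<Sum>n\<in>S. (cmod (x n U))\<^sup>2)"
      by (subst parseval)
        (simp_all add: x_def complex_norm_square cinner_cnj mult.commute del: of_real_power)
    moreover have "cinner B (mat_app B U v0) (mat_app B U v0) = 1"
      using U v0H v01 by (simp add: unitary_group_def)
    ultimately show ?thesis by (metis of_real_eq_1_iff)
  qed
  have le1: "(cmod (x n U))\<^sup>2 \<le> 1" if "U \<in> space \<mu>" "n \<in> S" for n U
    using member_le_sum[of n S "\<lambda>n. (cmod (x n U))\<^sup>2"] that finite_S sum1 by simp
  have meas: "x n \<in> borel_measurable \<mu>" for n
    unfolding x_def cinner_def mat_app_def
    by (intro borel_measurable_haar[OF haar] continuous_intros continuous_on_entry)
  define G where "G n m = (\<integral>U. (cmod (x n U))\<^sup>2 * (cmod (x m U))\<^sup>2 \<partial>\<mu>)" for n m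
  have int: "integrable \<mu> (\<lambda>U. (cmod (x n U))\<^sup>2 * (cmod (x m U))\<^sup>2)" if "n \<in> S" "m \<in> S" for n m
  proof (rule integrable_const_bound[where B = 1])
    show "AE U in \<mu>. norm ((cmod (x n U))\<^sup>2 * (cmod (x m U))\<^sup>2) \<le> 1"
      using le1 that by (intro AE_I2) (auto intro!: mult_le_one)
  qed (use meas in measurable)
  have p4: "cmod z ^ 4 = (cmod z)\<^sup>2 * (cmod z)\<^sup>2" for z
    by (simp flip: power_add)
  have int4: "integrable \<mu> (\<lambda>U. cmod (x n U) ^ 4)" if "n \<in> S" for n
    unfolding p4 by (rule int[OF that that])
  have G4: "(\<integral>U. cmod (x n U) ^ 4 \<partial>\<mu>) = G n n" for n
    unfolding G_def p4 ..
  have G_diag: "G m m = G n n" if "n \<in> S" "m \<in> S" for n m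
    unfolding G4[symmetric] x_def
    by (rule fourth_moment_unit_vectors[OF haar v0H]) (use that in \<open>simp_all add: orth e_in_H\<close>)
  have G_off: "2 * G n m = G n n" if "n \<in> S" "m \<in> S" "n \<noteq> m" for n m
  proof -
    \<comment> \<open>The conjugate compensates for antilinearity in the first argument, so the
      coordinate along \<open>w a\<close> is (x_n + a x_m) / sqrt 2. The inner product with
      \<open>e n\<close> is real for every phase a, as the reflection argument requires.\<close>
    define w where "w a = (\<lambda>i. complex_of_real (1 / sqrt 2) * e n i + complex_of_real (1 / sqrt 2) * cnj a * e m i)" for a
    have two: "complex_of_real (1 / sqrt 2) * complex_of_real (1 / sqrt 2) = 1 / 2"
      by (simp flip: of_real_mult)
    have wH: "w a \<in> H" for a
      unfolding w_def by (rule H_lincomb[OF e_in_H[OF that(1)] e_in_H[OF that(2)]])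
    have ww: "cinner B (w a) (w a) = 1" if "cnj a * a = 1" for a
    proof -
      have "cinner B (w a) (w a) = complex_of_real (1 / sqrt 2) * complex_of_real (1 / sqrt 2) * (1 + cnj a * a)"
        unfolding w_def cinner_add_left cinner_add_right cinner_scale_left cinner_scale_right
        using \<open>n \<in> S\<close> \<open>m \<in> S\<close> \<open>n \<noteq> m\<close> by (simp add: orth algebra_simps add_divide_distrib)
      then show ?thesis by (simp only: two that) simp
    qed
    have ew: "cinner B (e n) (w a) = complex_of_real (1 / sqrt 2)" for a
      unfolding w_def cinner_add_right cinner_scale_right using that by (simp add: orth)
    have wx: "cinner B (w a) (mat_app B U v0) = complex_of_real (1 / sqrt 2) * (x n U + a * x m U)" for a U
      unfolding w_def cinner_add_left cinner_scale_left x_def by (simp add: algebra_simps)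
    have mom: "(\<integral>U. cmod (x n U + a * x m U) ^ 4 \<partial>\<mu>) = 4 * G n n" if "cnj a * a = 1" for a
    proof -
      have "(\<integral>U. cmod (complex_of_real (1 / sqrt 2) * (x n U + a * x m U)) ^ 4 \<partial>\<mu>) = G n n"
        unfolding wx[symmetric] G4[symmetric] unfolding x_def
        by (rule fourth_moment_unit_vectors[OF haar v0H])
          (use \<open>n \<in> S\<close> in \<open>simp_all only: orth e_in_H wH ww[OF that] ew if_True simp_thms Reals_of_real\<close>)
      moreover have root: "cmod (complex_of_real (1 / sqrt 2) * z) ^ 4 = cmod z ^ 4 / 4" for z
      proof -
        have "sqrt 2 ^ 4 = (4::real)"
          by (simp add: power4_eq_xxxx)
        then show ?thesis by (simp add: norm_mult norm_divide power_mult_distrib power_divide)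
      qed
      ultimately have "(\<integral>U. cmod (x n U + a * x m U) ^ 4 / 4 \<partial>\<mu>) = G n n"
        by (simp only: root)
      then show ?thesis by simp
    qed
    have inta: "integrable \<mu> (\<lambda>U. cmod (x n U + a * x m U) ^ 4)" if "cmod a = 1" for a
    proof (rule integrable_const_bound[where B = "2 ^ 4"])
      show "AE U in \<mu>. norm (cmod (x n U + a * x m U) ^ 4) \<le> 2 ^ 4"
      proof (rule AE_I2)
        fix U assume U: "U \<in> space \<mu>"
        have "cmod (x n U) \<le> 1" "cmod (x m U) \<le> 1"
          using le1[OF U \<open>n \<in> S\<close>] le1[OF U \<open>m \<in> S\<close>] by (simp_all add: power_le_one_iff)
        then have "cmod (x n U + a * x m U) \<le> 2"
          using norm_triangle_ineq[of "x n U" "a * x m U"] that by (simp add: norm_mult)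
        then have "cmod (x n U + a * x m U) ^ 4 \<le> 2 ^ 4" by (rule power_mono) simp
        then show "norm (cmod (x n U + a * x m U) ^ 4) \<le> 2 ^ 4" by simp
      qed
    qed (use meas in measurable)
    \<comment> \<open>Each of the four phases contributes 4 G. The phase average turns the total
      into 8 G plus 16 times the mixed moment.\<close>
    have "16 * G n n = (\<integral>U. cmod (x n U + 1 * x m U) ^ 4 + cmod (x n U + \<i> * x m U) ^ 4
        + cmod (x n U + (-1) * x m U) ^ 4 + cmod (x n U + (-\<i>) * x m U) ^ 4 \<partial>\<mu>)"
      using inta[of 1] inta[of \<i>] inta[of "-1"] inta[of "-\<i>"]
        mom[of 1] mom[of \<i>] mom[of "-1"] mom[of "-\<i>"]
      by (simp del: mult_1 mult_minus1 mult_minus_left)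
    also have "\<dots> = (\<integral>U. 4 * (cmod (x n U) ^ 4 + cmod (x m U) ^ 4
        + 4 * ((cmod (x n U))\<^sup>2 * (cmod (x m U))\<^sup>2)) \<partial>\<mu>)"
      using cmod_phase_average by simp
    also have "\<dots> = 4 * (G n n + G m m + 4 * G n m)"
      using int4[OF that(1)] int4[OF that(2)] int[OF that(1,2)] by (simp add: G4, simp add: G_def)
    finally show ?thesis using G_diag[OF that(1,2)] by simp
  qed
  have "1 = (\<integral>U. (\<Sum>n\<in>S. (cmod (x n U))\<^sup>2) * (\<Sum>n\<in>S. (cmod (x n U))\<^sup>2) \<partial>\<mu>)"
    using Bochner_Integration.integral_cong[OF refl,
        of \<mu> "\<lambda>U. (\<Sum>n\<in>S. (cmod (x n U))\<^sup>2) * (\<Sum>n\<in>S. (cmod (x n U))\<^sup>2)" "\<lambda>U. 1"] sum1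
    by (simp add: prob_space)
  also have "\<dots> = (\<Sum>n\<in>S. \<Sum>m\<in>S. G n m)"
    unfolding sum_product G_def using int by simp
  also have "\<dots> = (\<Sum>k\<in>S. \<Sum>m\<in>S. G n n / 2 + (if m = k then G n n / 2 else 0))"
  proof (intro sum.cong refl)
    fix k m assume "k \<in> S" "m \<in> S"
    then show "G k m = G n n / 2 + (if m = k then G n n / 2 else 0)"
      using G_off[of k m] G_diag[OF n, of k] by auto
  qed
  also have "\<dots> = G n n * ((real (card S))\<^sup>2 + real (card S)) / 2"
    using finite_S by (simp add: sum.distrib) (simp add: power2_eq_square field_simps)
  finally have "G n n * ((real (card S))\<^sup>2 + real (card S)) = 2" by simp
  moreover from this have "(real (card S))\<^sup>2 + real (card S) \<noteq> 0" by auto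
  ultimately show ?thesis
    unfolding x_def[symmetric] G4 by (simp add: field_simps)
qed

section \<open>The dimension of a subspace with an orthonormal basis\<close>

lemma sum_fun_apply: "(\<Sum>n\<in>A. f n) i = (\<Sum>n\<in>A. f n i)"
  for f :: "'a \<Rightarrow> 'i \<Rightarrow> complex"
  by (induction A rule: infinite_finite_induct) auto

lemma e_inj: "inj_on e S"
  using orth by (intro inj_onI) (metis zero_neq_one)

lemma cdim_H: "cdim H = card S"
proof -
  have "cvec.independent (e ` S)"
  proof (rule cvec.independent_if_scalars_zero)
    fix f v assume 0: "(\<Sum>v\<in>e ` S. cscale (f v) v) = 0" and "v \<in> e ` S"
    then obtain n where n: "n \<in> S" "v = e n" by blast
    have "(\<Sum>v\<in>e ` S. cscale (f v) v) = (\<lambda>i. \<Sum>n\<in>S. f (e n) * e n i)"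
      by (simp add: sum.reindex[OF e_inj] fun_eq_iff sum_fun_apply cscale_def)
    then have "(\<lambda>i. \<Sum>n\<in>S. f (e n) * e n i) = (\<lambda>i. 0)" using 0 by (simp add: zero_fun_def)
    then have "f (e n) = cinner B (e n) (\<lambda>i. 0)"
      using cinner_e_comb[OF n(1), of "\<lambda>n. f (e n)"] by simp
    then show "f v = 0" by (simp add: n cinner_def)
  qed (simp add: finite_S)
  moreover have "v \<in> cvec.span (e ` S)" if "v \<in> H" for v
  proof -
    have "v = (\<Sum>n\<in>S. cscale (cinner B (e n) v) (e n))"
      by (subst expand[OF that]) (simp add: fun_eq_iff sum_fun_apply cscale_def)
    also have "\<dots> \<in> cvec.span (e ` S)"
      by (intro cvec.span_sum cvec.span_scale cvec.span_base) auto
    finally show ?thesis .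
  qed
  ultimately have "card (e ` S) = cvec.dim H"
    using e_in_H by (intro cvec.basis_card_eq_dim) auto
  then show ?thesis by (simp add: cdim_def card_image e_inj)
qed

end

section \<open>An orthonormal basis of the invariant subspace\<close>

lemma sum_quad_ix: "(\<Sum>i\<in>quad_ix a b c d. f i) = (\<Sum>p\<in>pair_ix a b. \<Sum>q\<in>pair_ix c d. f (p, q))"
  by (simp add: quad_ix_def sum.cartesian_product)

lemma finite_quad_ix [simp]: "finite (quad_ix a b c d)"
  by (simp add: quad_ix_def)

text \<open>A vector of the fourfold product is read as a matrix indexed by the two pairs, on which
  the group acts by M -> g M g^T. This brings invariants into the form required by
  \<open>schur_form\<close>.\<close>

lemma mat_app_quad_rep:
  "mat_app (quad_ix a b c d) (quad_rep a b c d g) v (p, q)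
    = mat_mul (pair_ix a b) (pair_rep a b g) (mat_mul (pair_ix c d) (curry v) (mtr (pair_rep c d g))) p q"
  by (simp add: mat_app_def sum_quad_ix quad_rep_def kron_def mat_mul_def mtr_def sum_distrib_left mult_ac)

lemma in_H_inv_iff:
  "v \<in> H_inv a b c d \<longleftrightarrow> msupp (pair_ix a b) (pair_ix c d) (curry v) \<and>
    (\<forall>g\<in>SU2. mat_mul (pair_ix a b) (pair_rep a b g)
      (mat_mul (pair_ix c d) (curry v) (mtr (pair_rep c d g))) = curry v)"
proof -
  have "v \<in> cspace (quad_ix a b c d) \<longleftrightarrow> msupp (pair_ix a b) (pair_ix c d) (curry v)"
    unfolding cspace_def msupp_def quad_ix_def by force
  moreover have "mat_app (quad_ix a b c d) (quad_rep a b c d g) v = v \<longleftrightarrow> mat_mul (pair_ix a b) (pair_rep a b g)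
      (mat_mul (pair_ix c d) (curry v) (mtr (pair_rep c d g))) = curry v" for g
    unfolding fun_eq_iff[of _ v] split_paired_all[symmetric] split_paired_All mat_app_quad_rep
    by (simp add: fun_eq_iff)
  ultimately show ?thesis
    by (simp add: H_inv_def invariants_def)
qed

lemma mat_app_comb:
  "mat_app B A (\<lambda>i. \<Sum>n\<in>S. c n * x n i) = (\<lambda>i. \<Sum>n\<in>S. c n * mat_app B A (x n) i)"
  unfolding mat_app_def sum_distrib_left by (intro ext, subst sum.swap) (simp add: mult_ac)

lemma invariants_comb:
  assumes "\<And>n. n \<in> S \<Longrightarrow> x n \<in> invariants B R"
  shows "(\<lambda>i. \<Sum>n\<in>S. c n * x n i) \<in> invariants B R"
  using assms by (simp add: invariants_def mat_app_comb cspace_def)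

text \<open>The invariant vector in \<open>V\<^sub>n \<otimes> V\<^sub>n \<subseteq> (V\<^sub>a \<otimes> V\<^sub>b) \<otimes> (V\<^sub>c \<otimes> V\<^sub>d)\<close>, up to normalisation.\<close>

definition inv_mat :: "nat \<Rightarrow> nat \<Rightarrow> nat \<Rightarrow> nat \<Rightarrow> nat \<Rightarrow> (nat \<times> nat, nat \<times> nat) cmat" where
  "inv_mat a b c d n = mat_mul {..n} (cgE a b n) (mat_mul {..n} (epsm n) (mtr (cgE c d n)))"

text \<open>For n in both coupling sets, the squared norm of \<open>inv_mat\<close> is the trace n +
  1 of \<open>cgP c d n\<close>, which explains the factor.\<close>

definition inv_vec :: "nat \<Rightarrow> nat \<Rightarrow> nat \<Rightarrow> nat \<Rightarrow> nat \<Rightarrow> quad cvec" where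
  "inv_vec a b c d n = (\<lambda>(p, q). of_real (1 / sqrt (real n + 1)) * inv_mat a b c d n p q)"

context
  fixes a b c d :: nat and S :: "nat set"
  assumes S_def: "S = cg_set a b \<inter> cg_set c d"
begin

lemma msupp_inv_mat: "n \<in> S \<Longrightarrow> msupp (pair_ix a b) (pair_ix c d) (inv_mat a b c d n)"
  using msupp_cgE[of n a b] msupp_cgE[of n c d]
  unfolding inv_mat_def S_def by (intro msupp_mat_mul[where C = "{..n}"]) auto

lemma cnj_inv_mat:
  assumes "n \<in> S"
  shows "cnj (inv_mat a b c d n p q) = inv_mat a b c d n p q"
proof -
  have "inv_mat a b c d n p q \<in> \<real>"
    unfolding inv_mat_def mat_mul_def mtr_def epsm_def
    using cgE_real[of n a b] cgE_real[of n c d] assms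
    by (intro sum_in_Reals Reals_mult) (auto simp: S_def)
  then show ?thesis by (simp add: Reals_cnj_iff)
qed

text \<open>Both couplings are equivariant, so the group elements pass through them and meet at
  \<open>epsm\<close>, which absorbs them.\<close>

lemma inv_mat_invariant:
  assumes "n \<in> S" "g \<in> SU2"
  shows "mat_mul (pair_ix a b) (pair_rep a b g)
      (mat_mul (pair_ix c d) (inv_mat a b c d n) (mtr (pair_rep c d g))) = inv_mat a b c d n"
proof -
  have n: "n \<in> cg_set a b" "n \<in> cg_set c d" using assms by (auto simp: S_def)
  have "mat_mul (pair_ix a b) (pair_rep a b g)
      (mat_mul (pair_ix c d) (inv_mat a b c d n) (mtr (pair_rep c d g)))
    = mat_mul {..n} (mat_mul (pair_ix a b) (pair_rep a b g) (cgE a b n))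
        (mat_mul {..n} (epsm n) (mtr (mat_mul (pair_ix c d) (pair_rep c d g) (cgE c d n))))"
    by (simp only: inv_mat_def mat_mul_assoc mtr_mat_mul)
  also have "\<dots> = mat_mul {..n} (cgE a b n) (mat_mul {..n} (mat_mul {..n} (spin_rep n g)
      (mat_mul {..n} (epsm n) (mtr (spin_rep n g)))) (mtr (cgE c d n)))"
    by (simp only: cgE_eqv[OF n(1) assms(2)] cgE_eqv[OF n(2) assms(2)] mat_mul_assoc mtr_mat_mul)
  also have "\<dots> = inv_mat a b c d n"
    by (simp only: spin_rep_epsm[OF assms(2)] inv_mat_def)
  finally show ?thesis .
qed

lemma inv_vec_in_H_inv:
  assumes "n \<in> S"
  shows "inv_vec a b c d n \<in> H_inv a b c d"
proof -
  have "curry (inv_vec a b c d n) = mscale (of_real (1 / sqrt (real n + 1))) (inv_mat a b c d n)"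
    by (simp add: inv_vec_def mscale_def curry_def)
  then show ?thesis
    unfolding in_H_inv_iff
    by (simp add: msupp_mscale msupp_inv_mat[OF assms] inv_mat_invariant[OF assms])
qed

text \<open>The sum is an entry of the transpose of one matrix times the other. Orthogonality of the
  couplings of the first pair kills different spins; for equal spins \<open>epsm\<close> cancels
  against its transpose and leaves the projection on the second pair.\<close>

lemma inv_mat_partial_trace:
  assumes "n \<in> S" "m \<in> S"
  shows "(\<Sum>p\<in>pair_ix a b. inv_mat a b c d n p q * inv_mat a b c d m p q')
    = (if n = m then cgP c d n q q' else 0)"
proof -
  have n: "n \<in> cg_set a b" "n \<in> cg_set c d" "m \<in> cg_set a b" "m \<in> cg_set c d"
    using assms by (auto simp: S_def)
  have "mat_mul (pair_ix a b) (mtr (inv_mat a b c d n)) (inv_mat a b c d m)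
    = mat_mul {..n} (cgE c d n) (mat_mul {..n} (mtr (epsm n)) (mat_mul {..m}
        (mat_mul (pair_ix a b) (mtr (cgE a b n)) (cgE a b m)) (mat_mul {..m} (epsm m) (mtr (cgE c d m)))))"
    by (simp only: inv_mat_def mat_mul_assoc mtr_mat_mul mtr_mtr)
  also have "\<dots> = (if n = m then mat_mul {..n} (cgE c d n) (mat_mul {..n}
      (mat_mul {..n} (mtr (epsm n)) (mat_mul {..n} (mid {..n}) (epsm n))) (mtr (cgE c d n))) else (\<lambda>q q'. 0))"
    by (auto simp: cgE_orth[OF n(1,3)] mat_mul_assoc)
  also have "\<dots> = (if n = m then cgP c d n else (\<lambda>q q'. 0))"
    using mat_mul_mid_left[of "{..n}" "{..n}" "epsm n"] msupp_cgE[OF n(2)]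
      mat_mul_mid_left[of "{..n}" "pair_ix c d" "mtr (cgE c d n)"]
    by (auto simp: mtr_epsm_epsm cgP_def)
  finally have "mat_mul (pair_ix a b) (mtr (inv_mat a b c d n)) (inv_mat a b c d m) q q'
      = (if n = m then cgP c d n else (\<lambda>q q'. 0)) q q'"
    by (rule arg_cong)
  then show ?thesis by (simp add: mat_mul_def mtr_def split: if_splits)
qed

lemma cinner_inv_vec:
  assumes "n \<in> S" "m \<in> S"
  shows "cinner (quad_ix a b c d) (inv_vec a b c d n) (inv_vec a b c d m) = (if n = m then 1 else 0)"
proof -
  have n: "n \<in> cg_set c d" using assms by (auto simp: S_def)
  have "cinner (quad_ix a b c d) (inv_vec a b c d n) (inv_vec a b c d m)
      = of_real (1 / sqrt (real n + 1) * (1 / sqrt (real m + 1)))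
        * (\<Sum>q\<in>pair_ix c d. \<Sum>p\<in>pair_ix a b. inv_mat a b c d n p q * inv_mat a b c d m p q)"
    unfolding cinner_def sum_quad_ix
    by (subst sum.swap) (simp add: inv_vec_def cnj_inv_mat[OF assms(1)] sum_distrib_left mult_ac)
  also have "\<dots> = of_real (1 / sqrt (real n + 1) * (1 / sqrt (real m + 1)))
        * (if n = m then of_real (real n + 1) else 0)"
    using cgP_trace[OF n] by (auto simp: inv_mat_partial_trace[OF assms])
  also have "\<dots> = (if n = m then 1 else 0)"
  proof (cases "n = m")
    case True
    have "1 / sqrt (real m + 1) * (1 / sqrt (real m + 1)) * (real m + 1) = 1"
      by simp
    then show ?thesis by (simp only: True if_True simp_thms of_real_mult[symmetric] of_real_1)
  qed simp
  finally show ?thesis .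
qed

text \<open>The two resolutions of the identity split \<open>M\<close> into blocks. Pulled back to
  V_n and V_m, a block is an invariant form, so by Schur's lemma only n = m contributes, with a
  multiple of \<open>epsm\<close>.\<close>

lemma H_inv_span:
  assumes v: "v \<in> H_inv a b c d"
  shows "\<exists>x. v = (\<lambda>i. \<Sum>n\<in>S. x n * inv_vec a b c d n i)"
proof -
  define M where "M = curry v"
  have supp: "msupp (pair_ix a b) (pair_ix c d) M"
    and inv: "\<And>g. g \<in> SU2 \<Longrightarrow> mat_mul (pair_ix a b) (pair_rep a b g)
      (mat_mul (pair_ix c d) M (mtr (pair_rep c d g))) = M"
    using v by (auto simp: in_H_inv_iff M_def)
  define N where "N n m = mat_mul (pair_ix a b) (mtr (cgE a b n)) (mat_mul (pair_ix c d) M (cgE c d m))" for n m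
  have "\<exists>x. N n m = (if n = m then mscale x (epsm m) else (\<lambda>i j. 0))"
    if nm: "n \<in> cg_set a b" "m \<in> cg_set c d" for n m
  proof (rule schur_form)
    show "msupp {..n} {..m} (N n m)"
      unfolding N_def using supp msupp_cgE[OF nm(1)] msupp_cgE[OF nm(2)]
      by (intro msupp_mat_mul[where C = "pair_ix a b"] msupp_mat_mul[where C = "pair_ix c d"]) auto
    fix g assume g: "g \<in> SU2"
    have "mat_mul {..n} (spin_rep n g) (mat_mul {..m} (N n m) (mtr (spin_rep m g)))
      = mat_mul (pair_ix a b) (mat_mul {..n} (spin_rep n g) (mtr (cgE a b n)))
          (mat_mul (pair_ix c d) M (mtr (mat_mul {..m} (spin_rep m g) (mtr (cgE c d m)))))"
      by (simp only: N_def mat_mul_assoc mtr_mat_mul mtr_mtr)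
    also have "\<dots> = mat_mul (pair_ix a b) (mtr (cgE a b n)) (mat_mul (pair_ix c d)
        (mat_mul (pair_ix a b) (pair_rep a b g) (mat_mul (pair_ix c d) M (mtr (pair_rep c d g)))) (cgE c d m))"
      by (simp only: cgE_eqv_mtr[OF nm(1) g] cgE_eqv_mtr[OF nm(2) g] mat_mul_assoc mtr_mat_mul mtr_mtr)
    also have "\<dots> = N n m"
      by (simp only: inv[OF g] N_def)
    finally show "mat_mul {..n} (spin_rep n g) (mat_mul {..m} (N n m) (mtr (spin_rep m g))) = N n m" .
  qed
  then obtain x where x: "\<And>n m. n \<in> cg_set a b \<Longrightarrow> m \<in> cg_set c d \<Longrightarrow>
      N n m = (if n = m then mscale (x n m) (epsm m) else (\<lambda>i j. 0))"
    by metis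
  have block: "mat_mul (pair_ix a b) (cgP a b n) (mat_mul (pair_ix c d) M (cgP c d m))
      = (if n = m then mscale (x n n) (inv_mat a b c d n) else (\<lambda>p q. 0))"
    if nm: "n \<in> cg_set a b" "m \<in> cg_set c d" for n m
  proof -
    have "mat_mul (pair_ix a b) (cgP a b n) (mat_mul (pair_ix c d) M (cgP c d m))
        = mat_mul {..n} (cgE a b n) (mat_mul {..m} (N n m) (mtr (cgE c d m)))"
      by (simp only: cgP_def N_def mat_mul_assoc)
    then show ?thesis using x[OF nm] by (auto simp: inv_mat_def)
  qed
  have "M = mat_mul (pair_ix a b) (mid (pair_ix a b)) (mat_mul (pair_ix c d) M (mid (pair_ix c d)))"
    using supp by (simp add: mat_mul_mid_left mat_mul_mid_right)
  also have "\<dots> = (\<lambda>p q. \<Sum>n\<in>cg_set a b. \<Sum>m\<in>cg_set c d.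
      mat_mul (pair_ix a b) (cgP a b n) (mat_mul (pair_ix c d) M (cgP c d m)) p q)"
    unfolding cgE_complete[symmetric] mat_mul_sum_left mat_mul_sum_right ..
  also have "\<dots> = (\<lambda>p q. \<Sum>n\<in>S. x n n * inv_mat a b c d n p q)"
  proof (intro ext)
    fix p q
    have "(\<Sum>n\<in>cg_set a b. \<Sum>m\<in>cg_set c d.
        mat_mul (pair_ix a b) (cgP a b n) (mat_mul (pair_ix c d) M (cgP c d m)) p q)
      = (\<Sum>n\<in>cg_set a b. \<Sum>m\<in>cg_set c d. if n = m then x n n * inv_mat a b c d n p q else 0)"
      by (intro sum.cong refl) (simp add: block mscale_def)
    also have "\<dots> = (\<Sum>n\<in>cg_set a b. if n \<in> cg_set c d then x n n * inv_mat a b c d n p q else 0)"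
      by simp
    also have "\<dots> = (\<Sum>n\<in>S. x n n * inv_mat a b c d n p q)"
      by (simp add: S_def sum.inter_restrict)
    finally show "(\<Sum>n\<in>cg_set a b. \<Sum>m\<in>cg_set c d.
        mat_mul (pair_ix a b) (cgP a b n) (mat_mul (pair_ix c d) M (cgP c d m)) p q)
      = (\<Sum>n\<in>S. x n n * inv_mat a b c d n p q)" .
  qed
  finally have M: "M = (\<lambda>p q. \<Sum>n\<in>S. x n n * inv_mat a b c d n p q)" .
  \<comment> \<open>The factor sqrt (n + 1) undoes the normalisation in
    \<open>inv_vec\<close>.\<close>
  have "v (p, q) = (\<Sum>n\<in>S. (of_real (sqrt (real n + 1)) * x n n) * inv_vec a b c d n (p, q))" for p q
  proof -
    have "v (p, q) = M p q" by (simp add: M_def)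
    also have "\<dots> = (\<Sum>n\<in>S. (of_real (sqrt (real n + 1)) * x n n) * inv_vec a b c d n (p, q))"
      unfolding M by (intro sum.cong refl) (simp add: inv_vec_def)
    finally show ?thesis .
  qed
  then show ?thesis
    by (intro exI[of _ "\<lambda>n. of_real (sqrt (real n + 1)) * x n n"]) (auto simp: fun_eq_iff)
qed

lemma onb_H_inv: "onb (quad_ix a b c d) (H_inv a b c d) S (inv_vec a b c d)"
proof
  show "finite S" by (simp add: S_def)
  show "(\<lambda>i. \<Sum>n\<in>S. x n * inv_vec a b c d n i) \<in> H_inv a b c d" for x
    unfolding H_inv_def using inv_vec_in_H_inv by (intro invariants_comb) (simp add: H_inv_def)
  show "inv_vec a b c d n \<in> cspace (quad_ix a b c d)" if "n \<in> S" for n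
    using inv_vec_in_H_inv[OF that] by (simp add: H_inv_def invariants_def)
  fix v assume "v \<in> H_inv a b c d"
  then obtain x where v: "v = (\<lambda>i. \<Sum>n\<in>S. x n * inv_vec a b c d n i)"
    using H_inv_span by blast
  have "cinner (quad_ix a b c d) (inv_vec a b c d n) v = x n" if "n \<in> S" for n
  proof -
    have "cinner (quad_ix a b c d) (inv_vec a b c d n) v = (\<Sum>m\<in>S. if n = m then x m else 0)"
      unfolding v cinner_sum_right by (rule sum.cong) (auto simp: cinner_inv_vec that)
    then show ?thesis using that by (simp add: S_def)
  qed
  then show "v = (\<lambda>i. \<Sum>n\<in>S. cinner (quad_ix a b c d) (inv_vec a b c d n) v * inv_vec a b c d n i)"
    by (subst v) simp
qed (simp_all add: cinner_inv_vec)

text \<open>The matrices \<open>inv_mat\<close> are real, so conjugation affects only the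
  coefficients, and the partial trace removes all cross terms between different spins.\<close>

lemma rho34_comb:
  assumes v: "v = (\<lambda>i. \<Sum>n\<in>S. x n * inv_vec a b c d n i)"
  shows "rho34 a b v = (\<lambda>q q'. \<Sum>n\<in>S. of_real ((cmod (x n))\<^sup>2 / (real n + 1)) * cgP c d n q q')"
proof (intro ext)
  fix q q'
  define s where "s n = complex_of_real (1 / sqrt (real n + 1))" for n :: nat
  have vp: "v (p, q) = (\<Sum>n\<in>S. x n * s n * inv_mat a b c d n p q)" for p q
    by (simp add: v inv_vec_def s_def)
  have vc: "cnj (v (p, q)) = (\<Sum>n\<in>S. cnj (x n) * s n * inv_mat a b c d n p q)" for p q
    unfolding vp cnj_sum by (rule sum.cong) (simp_all add: s_def cnj_inv_mat)
  have ss: "s n * s n = of_real (1 / (real n + 1))" for n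
    unfolding s_def of_real_mult[symmetric] by simp
  have "rho34 a b v q q' = (\<Sum>p\<in>pair_ix a b. \<Sum>n\<in>S. \<Sum>m\<in>S.
      (x n * s n * cnj (x m) * s m) * (inv_mat a b c d n p q * inv_mat a b c d m p q'))"
    by (simp add: rho34_def partial_trace_fst_def ket_bra_def vc)
      (simp add: vp sum_product mult_ac)
  also have "\<dots> = (\<Sum>n\<in>S. \<Sum>m\<in>S. (x n * s n * cnj (x m) * s m) *
      (\<Sum>p\<in>pair_ix a b. inv_mat a b c d n p q * inv_mat a b c d m p q'))"
    unfolding sum_distrib_left by (subst sum.swap, subst (2) sum.swap) (rule refl)
  also have "\<dots> = (\<Sum>n\<in>S. \<Sum>m\<in>S. if n = m then (x n * cnj (x n)) * (s n * s n) * cgP c d n q q' else 0)"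
    by (intro sum.cong refl) (simp add: inv_mat_partial_trace mult_ac)
  also have "\<dots> = (\<Sum>n\<in>S. of_real ((cmod (x n))\<^sup>2 / (real n + 1)) * cgP c d n q q')"
  proof (rule sum.cong)
    fix n assume "n \<in> S"
    moreover have "finite S" by (simp add: S_def)
    ultimately show "(\<Sum>m\<in>S. if n = m then (x n * cnj (x n)) * (s n * s n) * cgP c d n q q' else 0)
        = of_real ((cmod (x n))\<^sup>2 / (real n + 1)) * cgP c d n q q'"
      by (simp add: ss flip: complex_norm_square)
  qed simp
  finally show "rho34 a b v q q' = \<dots>" .
qed

text \<open>The projections are mutually orthogonal, so squaring acts on the eigenvalues |x_n|^2 /
  (n + 1); the trace n + 1 cancels one of the two denominators.\<close>

lemma Z1_comb:
  assumes v: "v = (\<lambda>i. \<Sum>n\<in>S. x n * inv_vec a b c d n i)"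
  shows "Z1 a b c d v = of_real (\<Sum>n\<in>S. cmod (x n) ^ 4 / (real n + 1))"
proof -
  define y where "y n = complex_of_real ((cmod (x n))\<^sup>2 / (real n + 1))" for n
  have rho: "rho34 a b v = (\<lambda>q q'. \<Sum>n\<in>S. mscale (y n) (cgP c d n) q q')"
    by (simp add: rho34_comb[OF v] y_def mscale_def)
  have "mat_mul (pair_ix c d) (rho34 a b v) (rho34 a b v)
      = (\<lambda>q q'. \<Sum>n\<in>S. \<Sum>m\<in>S. if n = m then y n * y n * cgP c d n q q' else 0)"
    unfolding rho mat_mul_sum_left mat_mul_sum_right
    by (intro ext sum.cong refl) (auto simp: cgP_orth S_def, auto simp: mscale_def)
  also have "\<dots> = (\<lambda>q q'. \<Sum>n\<in>S. y n * y n * cgP c d n q q')"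
    by (intro ext sum.cong refl) (simp add: S_def)
  finally have "Z1 a b c d v = (\<Sum>n\<in>S. y n * y n * (\<Sum>q\<in>pair_ix c d. cgP c d n q q))"
    unfolding Z1_def mat_trace_def by (simp add: sum_distrib_left) (rule sum.swap)
  also have "\<dots> = (\<Sum>n\<in>S. of_real (cmod (x n) ^ 4 / (real n + 1)))"
  proof (rule sum.cong)
    fix n assume "n \<in> S"
    then have "y n * y n * (\<Sum>q\<in>pair_ix c d. cgP c d n q q) = y n * y n * of_real (real n + 1)"
      by (simp add: cgP_trace S_def)
    also have "\<dots> = of_real ((cmod (x n))\<^sup>2 / (real n + 1) * ((cmod (x n))\<^sup>2 / (real n + 1)) * (real n + 1))"
      by (simp add: y_def)
    also have "(cmod (x n))\<^sup>2 / (real n + 1) * ((cmod (x n))\<^sup>2 / (real n + 1)) * (real n + 1)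
        = cmod (x n) ^ 4 / (real n + 1)"
    proof -
      have "t / k * (t / k) * k = t * t / k" if "k \<noteq> 0" for t k :: real
        using that by simp
      moreover have "(cmod (x n))\<^sup>2 * (cmod (x n))\<^sup>2 = cmod (x n) ^ 4"
        by (simp flip: power_add)
      ultimately show ?thesis by (metis add.commute of_nat_Suc of_nat_neq_0)
    qed
    finally show "y n * y n * (\<Sum>q\<in>pair_ix c d. cgP c d n q q) = of_real (cmod (x n) ^ 4 / (real n + 1))" .
  qed simp
  finally show ?thesis by simp
qed

end

text \<open>A partial trace followed by the remaining trace is the full trace of the ket-bra, which
  is the squared norm.\<close>

lemma Z0_eq: "Z0 a b c d v = (cinner (quad_ix a b c d) v v)\<^sup>2"
  unfolding Z0_def mat_trace_def rho34_def partial_trace_fst_def ket_bra_def cinner_def sum_quad_ix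
  by (subst sum.swap) (simp add: mult.commute)

section \<open>Haar averages\<close>

lemma haar_averages:
  assumes "haar_setup a b c d \<mu> v0" and S: "S = intermediate_spins a b c d"
  shows "S \<noteq> {}" and "finite S" and "cdim (H_inv a b c d) = card S"
    and "avg_Z1 a b c d \<mu> v0 = of_real
      (2 * (\<Sum>n\<in>S. 1 / (real n + 1)) / ((real (card S))\<^sup>2 + real (card S)))"
    and "avg_Z0 a b c d \<mu> v0 = 1"
proof -
  let ?B = "quad_ix a b c d" and ?H = "H_inv a b c d"
  have haar: "haar_measure ?B ?H \<mu>" and v0: "unit_vector ?B ?H v0"
    using assms(1) by (auto simp: haar_setup_def)
  have S_def: "S = cg_set a b \<inter> cg_set c d"
    using S by (simp add: intermediate_spins_eq)
  interpret onb ?B ?H S "inv_vec a b c d"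
    by (rule onb_H_inv[OF S_def])
  interpret prob_space \<mu> using haar by (simp add: haar_measure_def)
  show "S \<noteq> {}"
  proof
    assume "S = {}"
    then have "v0 = (\<lambda>i. 0)"
      using expand[of v0] v0 by (simp add: unit_vector_def)
    then show False using v0 by (simp add: unit_vector_def cinner_def)
  qed
  show fin: "finite S" by (rule finite_S)
  show "cdim ?H = card S" by (rule cdim_H)
  define D where "D = (real (card S))\<^sup>2 + real (card S)"
  have D: "D > 0" using fin \<open>S \<noteq> {}\<close> by (simp add: D_def card_gt_0_iff add_nonneg_pos)
  define x where "x n U = cinner ?B (inv_vec a b c d n) (mat_app ?B U v0)" for n U
  have mom: "(\<integral>U. cmod (x n U) ^ 4 \<partial>\<mu>) = 2 / D" if "n \<in> S" for n
    unfolding x_def D_def by (rule fourth_moment[OF haar v0 that])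
  \<comment> \<open>The Bochner integral of a non-integrable function is 0 by convention, so the
    positive value 2 / D already certifies integrability.\<close>
  have int: "integrable \<mu> (\<lambda>U. cmod (x n U) ^ 4)" if "n \<in> S" for n
    using mom[OF that] D not_integrable_integral_eq[of \<mu> "\<lambda>U. cmod (x n U) ^ 4"] by auto
  have in_H: "mat_app ?B U v0 \<in> ?H" if "U \<in> space \<mu>" for U
    using that haar v0 by (auto simp: haar_measure_def unitary_group_def unit_vector_def)
  have "avg_Z1 a b c d \<mu> v0 = (\<integral>U. of_real (\<Sum>n\<in>S. cmod (x n U) ^ 4 / (real n + 1)) \<partial>\<mu>)"
    unfolding avg_Z1_def haar_avg_def
  proof (rule Bochner_Integration.integral_cong[OF refl])
    fix U assume "U \<in> space \<mu>"
    from expand[OF in_H[OF this]]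
    show "Z1 a b c d (mat_app ?B U v0) = of_real (\<Sum>n\<in>S. cmod (x n U) ^ 4 / (real n + 1))"
      unfolding x_def by (rule Z1_comb[OF S_def])
  qed
  also have "\<dots> = of_real (\<integral>U. (\<Sum>n\<in>S. cmod (x n U) ^ 4 / (real n + 1)) \<partial>\<mu>)"
    by (rule integral_complex_of_real)
  also have "(\<integral>U. (\<Sum>n\<in>S. cmod (x n U) ^ 4 / (real n + 1)) \<partial>\<mu>) = (\<Sum>n\<in>S. (2 / D) / (real n + 1))"
    by (subst Bochner_Integration.integral_sum) (auto simp: int mom)
  also have "\<dots> = 2 * (\<Sum>n\<in>S. 1 / (real n + 1)) / D"
    by (simp add: sum_distrib_left sum_divide_distrib mult_ac)
  finally show "avg_Z1 a b c d \<mu> v0 = of_real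
      (2 * (\<Sum>n\<in>S. 1 / (real n + 1)) / ((real (card S))\<^sup>2 + real (card S)))"
    by (simp only: D_def)
  have "avg_Z0 a b c d \<mu> v0 = (\<integral>U. 1 \<partial>\<mu>)"
    unfolding avg_Z0_def haar_avg_def
  proof (rule Bochner_Integration.integral_cong[OF refl])
    fix U assume "U \<in> space \<mu>"
    then show "Z0 a b c d (mat_app ?B U v0) = 1"
      using haar v0 by (simp add: Z0_eq haar_measure_def unitary_group_def unit_vector_def)
  qed
  then show "avg_Z0 a b c d \<mu> v0 = 1"
    by (simp add: prob_space)
qed

lemma avg_S2_eq:
  assumes "haar_setup a b c d \<mu> v0" and S: "S = intermediate_spins a b c d"
  shows "avg_S2 a b c d \<mu> v0
    = ln ((real (card S))\<^sup>2 + real (card S)) - ln (2 * (\<Sum>n\<in>S. 1 / (real n + 1)))"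
proof -
  note facts = haar_averages[OF assms]
  have "card S > 0" using facts by (simp add: card_gt_0_iff)
  then have "(real (card S))\<^sup>2 + real (card S) > 0" by (simp add: add_nonneg_pos)
  moreover have "(\<Sum>n\<in>S. 1 / (real n + 1)) > 0"
    using facts by (intro sum_pos) auto
  ultimately show ?thesis
    unfolding avg_S2_def facts(4,5) by (simp add: ln_div)
qed

section \<open>Equal spins and the large-spin limit\<close>

lemma cg_set_diag: "cg_set n n = (\<lambda>k. 2 * k) ` {0..n}"
proof -
  have "(\<lambda>k. n + n - 2 * k) ` {..n} = (\<lambda>k. 2 * k) ` {0..n}"
  proof (intro set_eqI iffI)
    fix m assume "m \<in> (\<lambda>k. n + n - 2 * k) ` {..n}"
    then obtain k where "k \<le> n" "m = 2 * (n - k)" by auto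
    then show "m \<in> (\<lambda>k. 2 * k) ` {0..n}" by (intro image_eqI[of _ _ "n - k"]) auto
  next
    fix m assume "m \<in> (\<lambda>k. 2 * k) ` {0..n}"
    then obtain k where "k \<le> n" "m = 2 * k" by auto
    then show "m \<in> (\<lambda>k. n + n - 2 * k) ` {..n}" by (intro image_eqI[of _ _ "n - k"]) auto
  qed
  then show ?thesis by (simp add: cg_set_def)
qed

lemma card_cg_set_diag: "card (cg_set n n) = n + 1"
  by (simp add: cg_set_diag card_image inj_on_def)

lemma sum_cg_set_diag: "(\<Sum>m\<in>cg_set n n. 1 / (real m + 1)) = (\<Sum>I = 0..n. 1 / (2 * real I + 1))"
  by (simp add: cg_set_diag sum.reindex inj_on_def)

lemma avg_S2_diag:
  assumes "haar_setup n n n n \<mu> v0"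
  shows "avg_S2 n n n n \<mu> v0 = ln ((real n + 1)\<^sup>2 + (real n + 1))
    - ln (2 * (\<Sum>I = 0..n. 1 / (2 * real I + 1)))"
  using avg_S2_eq[OF assms refl]
  unfolding intermediate_spins_eq Int_absorb card_cg_set_diag sum_cg_set_diag of_nat_add of_nat_1 .

text \<open>Only the logarithm of this sum enters the entropy, so a logarithmic upper bound leaves a
  correction of order ln ln n.\<close>

lemma odd_harmonic_bounds:
  "1 \<le> (\<Sum>I = 0..n. 1 / (2 * real I + 1))"
  "(\<Sum>I = 0..n. 1 / (2 * real I + 1)) \<le> 1 + ln (real n + 1)"
proof -
  show "1 \<le> (\<Sum>I = 0..n. 1 / (2 * real I + 1))"
    by (induction n) (auto intro: add_increasing2)
  show "(\<Sum>I = 0..n. 1 / (2 * real I + 1)) \<le> 1 + ln (real n + 1)"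
  proof (induction n)
    case (Suc n)
    \<comment> \<open>The inequality ln t <= t - 1 at t = (n + 1) / (n + 2) bounds 1 / (n + 2) by
      the increment of the logarithm, and the new summand 1 / (2n + 3) is smaller.\<close>
    have "ln ((real n + 1) / (real n + 2)) \<le> (real n + 1) / (real n + 2) - 1"
      by (rule ln_le_minus_one) simp
    also have "\<dots> = - (1 / (real n + 2))" by (simp add: field_simps)
    also have "\<dots> \<le> - (1 / (2 * real (Suc n) + 1))" by (simp add: frac_le)
    finally have "1 / (2 * real (Suc n) + 1) \<le> ln (real n + 2) - ln (real n + 1)"
      by (simp add: ln_div)
    then show ?case using Suc.IH by (simp add: add.commute)
  qed simp
qed

text \<open>The harmonic sum lies between 1 and 1 + ln (n + 1), so the entropy is squeezed between
  two explicit functions whose ratios to 2 ln (n + 1) tend to 1.\<close>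

lemma avg_S2_asymptotics:
  assumes "\<And>n. haar_setup n n n n (\<mu> n) (v0 n)"
  shows "(\<lambda>n. avg_S2 n n n n (\<mu> n) (v0 n) / ln ((real n + 1)\<^sup>2)) \<longlonglongrightarrow> 1"
proof (rule tendsto_sandwich)
  \<comment> \<open>At n = 0 the denominator is ln 1 = 0 and all quotients are 0, so nonnegativity
    suffices for dividing the inequalities.\<close>
  have ln: "ln ((real n + 1)\<^sup>2) \<ge> 0" for n by simp
  show "\<forall>\<^sub>F n in sequentially. (ln ((real n + 1)\<^sup>2 + (real n + 1)) - ln (2 * (1 + ln (real n + 1))))
      / ln ((real n + 1)\<^sup>2) \<le> avg_S2 n n n n (\<mu> n) (v0 n) / ln ((real n + 1)\<^sup>2)"
  proof (intro always_eventually allI divide_right_mono ln)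
    fix n
    have "ln (2 * (\<Sum>I = 0..n. 1 / (2 * real I + 1))) \<le> ln (2 * (1 + ln (real n + 1)))"
      using odd_harmonic_bounds[of n] by (intro ln_mono) auto
    then show "ln ((real n + 1)\<^sup>2 + (real n + 1)) - ln (2 * (1 + ln (real n + 1)))
        \<le> avg_S2 n n n n (\<mu> n) (v0 n)"
      by (simp only: avg_S2_diag[OF assms])
  qed
  show "\<forall>\<^sub>F n in sequentially. avg_S2 n n n n (\<mu> n) (v0 n) / ln ((real n + 1)\<^sup>2)
      \<le> ln ((real n + 1)\<^sup>2 + (real n + 1)) / ln ((real n + 1)\<^sup>2)"
  proof (intro always_eventually allI divide_right_mono ln)
    fix n
    have "ln (2 * (\<Sum>I = 0..n. 1 / (2 * real I + 1))) \<ge> 0"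
      using odd_harmonic_bounds(1)[of n] by (intro ln_ge_zero) simp
    then show "avg_S2 n n n n (\<mu> n) (v0 n) \<le> ln ((real n + 1)\<^sup>2 + (real n + 1))"
      by (simp only: avg_S2_diag[OF assms])
  qed
qed real_asymp+

theorem mainTheorem3:
  shows "(\<forall>n1 n2 n3 n4 \<mu> v0.
            H_inv n1 n2 n3 n4 \<noteq> {0} \<and> haar_setup n1 n2 n3 n4 \<mu> v0 \<longrightarrow>
            avg_Z1 n1 n2 n3 n4 \<mu> v0 = complex_of_real
              (2 * (\<Sum>I\<in>intermediate_spins n1 n2 n3 n4. 1 / (2 * spin I + 1)) /
               ((real (cdim (H_inv n1 n2 n3 n4)))\<^sup>2 + real (cdim (H_inv n1 n2 n3 n4)))) \<and>
            avg_Z0 n1 n2 n3 n4 \<mu> v0 = 1 \<and>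
            avg_S2 n1 n2 n3 n4 \<mu> v0 =
              ln ((real (cdim (H_inv n1 n2 n3 n4)))\<^sup>2 + real (cdim (H_inv n1 n2 n3 n4))) -
              ln (2 * (\<Sum>I\<in>intermediate_spins n1 n2 n3 n4. 1 / (2 * spin I + 1))))
       \<and> (\<forall>n. real (cdim (H_inv n n n n)) = 2 * spin n + 1)
       \<and> (\<forall>n \<mu> v0. haar_setup n n n n \<mu> v0 \<longrightarrow>
            avg_S2 n n n n \<mu> v0 =
              ln ((2 * spin n + 1)\<^sup>2 + (2 * spin n + 1)) -
              ln (2 * (\<Sum>I = 0..n. 1 / (2 * real I + 1))))
       \<and> (\<forall>\<mu> v0. (\<forall>n. haar_setup n n n n (\<mu> n) (v0 n)) \<longrightarrow>
            (\<lambda>n. avg_S2 n n n n (\<mu> n) (v0 n) / ln ((2 * spin n + 1)\<^sup>2)) \<longlonglongrightarrow> 1)"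
proof -
  have spin: "2 * spin n + 1 = real n + 1" for n
    by (simp add: spin_def)
  \<comment> \<open>This claim mentions no Haar measure, so it comes from the basis
    \<open>inv_vec\<close> and the count n + 1 of its indices.\<close>
  have dim: "real (cdim (H_inv n n n n)) = real n + 1" for n
    using onb.cdim_H[OF onb_H_inv[OF refl, of n n n n]] by (simp add: card_cg_set_diag)
  show ?thesis
    unfolding spin
  proof (intro conjI allI impI)
    fix n1 n2 n3 n4 \<mu> v0
    assume "H_inv n1 n2 n3 n4 \<noteq> {0} \<and> haar_setup n1 n2 n3 n4 \<mu> v0"
    then have hs: "haar_setup n1 n2 n3 n4 \<mu> v0" by simp
    note facts = haar_averages[OF hs refl]
    show "avg_Z1 n1 n2 n3 n4 \<mu> v0 = complex_of_real
        (2 * (\<Sum>I\<in>intermediate_spins n1 n2 n3 n4. 1 / (real I + 1)) /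
         ((real (cdim (H_inv n1 n2 n3 n4)))\<^sup>2 + real (cdim (H_inv n1 n2 n3 n4))))"
      unfolding facts(3) by (rule facts(4))
    show "avg_Z0 n1 n2 n3 n4 \<mu> v0 = 1" by (rule facts(5))
    show "avg_S2 n1 n2 n3 n4 \<mu> v0 =
        ln ((real (cdim (H_inv n1 n2 n3 n4)))\<^sup>2 + real (cdim (H_inv n1 n2 n3 n4))) -
        ln (2 * (\<Sum>I\<in>intermediate_spins n1 n2 n3 n4. 1 / (real I + 1)))"
      unfolding facts(3) by (rule avg_S2_eq[OF hs refl])
  qed (use dim avg_S2_diag avg_S2_asymptotics in blast)+
qed

end
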